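(* Let $R$ be a commutative refinement ring and let $M$ and $N$ be finitely generated projective $R$-modules. Then $M\cong N$ if and only if $M_P\cong N_P$ for every prime ideal $P$ of $R$.
   Context: All rings are associative with identity and modules are unital right modules. $V(R)$ denotes the monoid of isomorphism classes of finitely generated projective $R$-modules under direct sum. A ring $R$ is a refinement ring if $V(R)$ has the refinement property: whenever $x_1+x_2=y_1+y_2$ in $V(R)$, there exist $z_{ij}\in V(R)$ ($i,j\in\{1,2\}$) with $x_i=z_{i1}+z_{i2}$ and $y_j=z_{1j}+z_{2j}$. $M_P=M\otimes_R R_P$ denotes the localization at $P$. *)

theory Defs
  imports "HOL-Algebra.Module" "HOL-Algebra.Ideal"
begin

definition lin_map ::
  "('a, 'c) ring_scheme \<Rightarrow> ('a, 'b, 'd) module_scheme \<Rightarrow> ('a, 'e, 'f) module_scheme \<Rightarrow> ('b \<Rightarrow> 'e) \<Rightarrow> bool"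
  where "lin_map R M N f \<longleftrightarrow>
    f \<in> carrier M \<rightarrow> carrier N \<and>
    (\<forall>x\<in>carrier M. \<forall>y\<in>carrier M. f (x \<oplus>\<^bsub>M\<^esub> y) = f x \<oplus>\<^bsub>N\<^esub> f y) \<and>
    (\<forall>a\<in>carrier R. \<forall>x\<in>carrier M. f (a \<odot>\<^bsub>M\<^esub> x) = a \<odot>\<^bsub>N\<^esub> f x)"

definition mod_iso ::
  "('a, 'c) ring_scheme \<Rightarrow> ('a, 'b, 'd) module_scheme \<Rightarrow> ('a, 'e, 'f) module_scheme \<Rightarrow> bool"
  where "mod_iso R M N \<longleftrightarrow> (\<exists>f. lin_map R M N f \<and> bij_betw f (carrier M) (carrier N))"

definition free_mod :: "('a, 'c) ring_scheme \<Rightarrow> nat \<Rightarrow> ('a, nat \<Rightarrow> 'a) module"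
  where "free_mod R n =
    \<lparr>carrier = {v. (\<forall>i<n. v i \<in> carrier R) \<and> (\<forall>i\<ge>n. v i = \<zero>\<^bsub>R\<^esub>)},
     mult = (\<lambda>v w i. v i \<otimes>\<^bsub>R\<^esub> w i),
     one = (\<lambda>i. if i < n then \<one>\<^bsub>R\<^esub> else \<zero>\<^bsub>R\<^esub>),
     zero = (\<lambda>i. \<zero>\<^bsub>R\<^esub>),
     add = (\<lambda>v w i. v i \<oplus>\<^bsub>R\<^esub> w i),
     smult = (\<lambda>a v i. a \<otimes>\<^bsub>R\<^esub> v i)\<rparr>"

definition dsum :: "('a, 'b, 'd) module_scheme \<Rightarrow> ('a, 'e, 'f) module_scheme \<Rightarrow> ('a, 'b \<times> 'e) module"
  where "dsum M N =
    \<lparr>carrier = carrier M \<times> carrier N,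
     mult = (\<lambda>x y. (fst x \<otimes>\<^bsub>M\<^esub> fst y, snd x \<otimes>\<^bsub>N\<^esub> snd y)),
     one = (\<one>\<^bsub>M\<^esub>, \<one>\<^bsub>N\<^esub>),
     zero = (\<zero>\<^bsub>M\<^esub>, \<zero>\<^bsub>N\<^esub>),
     add = (\<lambda>x y. (fst x \<oplus>\<^bsub>M\<^esub> fst y, snd x \<oplus>\<^bsub>N\<^esub> snd y)),
     smult = (\<lambda>a x. (a \<odot>\<^bsub>M\<^esub> fst x, a \<odot>\<^bsub>N\<^esub> snd x))\<rparr>"

definition fg_proj :: "('a, 'c) ring_scheme \<Rightarrow> ('a, 'b, 'd) module_scheme \<Rightarrow> bool"
  where "fg_proj R M \<longleftrightarrow> module R M \<and>
    (\<exists>n i p. lin_map R M (free_mod R n) i \<and> lin_map R (free_mod R n) M p \<and>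
             (\<forall>x\<in>carrier M. p (i x) = x))"

text \<open>V(R) has refinement. Every f.g. projective R-module is isomorphic to a submodule
  of some R^n, hence to a module with carrier in type nat => 'a; so quantifying over
  such modules ranges over all of V(R).\<close>
definition refinement_ring :: "('a, 'c) ring_scheme \<Rightarrow> bool"
  where "refinement_ring R \<longleftrightarrow>
    (\<forall>(X1::('a, nat \<Rightarrow> 'a) module) (X2::('a, nat \<Rightarrow> 'a) module) (Y1::('a, nat \<Rightarrow> 'a) module) (Y2::('a, nat \<Rightarrow> 'a) module).
       fg_proj R X1 \<and> fg_proj R X2 \<and> fg_proj R Y1 \<and> fg_proj R Y2 \<and>
       mod_iso R (dsum X1 X2) (dsum Y1 Y2) \<longrightarrow>
       (\<exists>(Z11::('a, nat \<Rightarrow> 'a) module) (Z12::('a, nat \<Rightarrow> 'a) module) (Z21::('a, nat \<Rightarrow> 'a) module) (Z22::('a, nat \<Rightarrow> 'a) module).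
          fg_proj R Z11 \<and> fg_proj R Z12 \<and> fg_proj R Z21 \<and> fg_proj R Z22 \<and>
          mod_iso R X1 (dsum Z11 Z12) \<and> mod_iso R X2 (dsum Z21 Z22) \<and>
          mod_iso R Y1 (dsum Z11 Z21) \<and> mod_iso R Y2 (dsum Z12 Z22)))"

definition ring_as_module :: "('a, 'c) ring_scheme \<Rightarrow> ('a, 'a) module"
  where "ring_as_module R =
    \<lparr>carrier = carrier R, mult = mult R, one = one R, zero = zero R, add = add R,
     smult = mult R\<rparr>"

definition loc_rel :: "('a, 'c) ring_scheme \<Rightarrow> 'a set \<Rightarrow> ('a, 'b, 'd) module_scheme
    \<Rightarrow> (('b \<times> 'a) \<times> ('b \<times> 'a)) set"
  where "loc_rel R P M = {((m, s), (n, t)).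
     m \<in> carrier M \<and> n \<in> carrier M \<and> s \<in> carrier R - P \<and> t \<in> carrier R - P \<and>
     (\<exists>u \<in> carrier R - P. u \<odot>\<^bsub>M\<^esub> (t \<odot>\<^bsub>M\<^esub> m) = u \<odot>\<^bsub>M\<^esub> (s \<odot>\<^bsub>M\<^esub> n))}"

definition loc_cls :: "('a, 'c) ring_scheme \<Rightarrow> 'a set \<Rightarrow> ('a, 'b, 'd) module_scheme
    \<Rightarrow> 'b \<Rightarrow> 'a \<Rightarrow> ('b \<times> 'a) set"
  where "loc_cls R P M m s = loc_rel R P M `` {(m, s)}"

definition loc_ring :: "('a, 'c) ring_scheme \<Rightarrow> 'a set \<Rightarrow> ('a \<times> 'a) set ring"
  where "loc_ring R P =
    (let RM = ring_as_module R; cl = loc_cls R P RM in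
    \<lparr>carrier = (carrier R \<times> (carrier R - P)) // loc_rel R P RM,
     mult = (\<lambda>X Y. \<Union>{cl (a \<otimes>\<^bsub>R\<^esub> b) (s \<otimes>\<^bsub>R\<^esub> t) | a s b t. (a, s) \<in> X \<and> (b, t) \<in> Y}),
     one = cl \<one>\<^bsub>R\<^esub> \<one>\<^bsub>R\<^esub>,
     zero = cl \<zero>\<^bsub>R\<^esub> \<one>\<^bsub>R\<^esub>,
     add = (\<lambda>X Y. \<Union>{cl (t \<otimes>\<^bsub>R\<^esub> a \<oplus>\<^bsub>R\<^esub> s \<otimes>\<^bsub>R\<^esub> b) (s \<otimes>\<^bsub>R\<^esub> t)
                       | a s b t. (a, s) \<in> X \<and> (b, t) \<in> Y})\<rparr>)"

definition loc_mod :: "('a, 'c) ring_scheme \<Rightarrow> 'a set \<Rightarrow> ('a, 'b, 'd) module_scheme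
    \<Rightarrow> (('a \<times> 'a) set, ('b \<times> 'a) set) module"
  where "loc_mod R P M =
    (let cl = loc_cls R P M in
    \<lparr>carrier = (carrier M \<times> (carrier R - P)) // loc_rel R P M,
     mult = (\<lambda>X Y. cl \<zero>\<^bsub>M\<^esub> \<one>\<^bsub>R\<^esub>),
     one = cl \<zero>\<^bsub>M\<^esub> \<one>\<^bsub>R\<^esub>,
     zero = cl \<zero>\<^bsub>M\<^esub> \<one>\<^bsub>R\<^esub>,
     add = (\<lambda>X Y. \<Union>{cl (t \<odot>\<^bsub>M\<^esub> m \<oplus>\<^bsub>M\<^esub> s \<odot>\<^bsub>M\<^esub> n) (s \<otimes>\<^bsub>R\<^esub> t)
                       | m s n t. (m, s) \<in> X \<and> (n, t) \<in> Y}),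
     smult = (\<lambda>A X. \<Union>{cl (a \<odot>\<^bsub>M\<^esub> m) (s \<otimes>\<^bsub>R\<^esub> t)
                       | a s m t. (a, s) \<in> A \<and> (m, t) \<in> X})\<rparr>)"

end

theory Submission
  imports "HOL-Algebra.Ring_Divisibility" Defs
begin

text \<open>Since a finitely generated projective \<open>M\<close> is a summand of \<open>R\<^sup>n\<close>, refinement splits it into
  summands of \<open>R\<close>, so \<open>M \<cong> e\<^sub>1R \<oplus> \<dots> \<oplus> e\<^sub>kR\<close> with idempotents \<open>e\<^sub>i\<close>. The isomorphism
  \<open>eR \<oplus> fR \<cong> (e + f - ef)R \<oplus> efR\<close> allows one to assume \<open>e\<^sub>1 \<ge> \<dots> \<ge> e\<^sub>k\<close>. The rank of \<open>M\<^sub>P\<close> is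
  the number of \<open>e\<^sub>i\<close> outside \<open>P\<close>. As every nonzero idempotent avoids some prime ideal, these
  ranks determine the descending chain up to trailing zeros. No residue fields are needed for the
  invariance of the rank: an isomorphism \<open>M\<^sub>P \<cong> N\<^sub>P\<close> lifts to maps \<open>M \<rightarrow> N \<rightarrow> M\<close> over \<open>R\<close> whose
  composite is, locally at \<open>P\<close>, multiplication by some \<open>s \<notin> P\<close>, and one eliminates modulo \<open>P\<close>.\<close>

subsection \<open>Linear maps and direct sums\<close>

text \<open>\<open>refinement_ring\<close> speaks about modules carried by
  \<open>nat \<Rightarrow> 'a\<close>, whereas \<open>M\<close> and \<open>N\<close> have arbitrary
  carrier types, so each is first replaced by its image under a split embedding into R^n. Refinement
  acts on equations between direct sums; hence a complement X' is carried along, and the induction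
  on n refines X + X' = R + R^n. Ordering the idempotents is what makes the ranks decisive. A prime
  containing the head of a descending chain contains the whole chain, so the rank vanishes exactly
  where the head lies in P. This recovers the head, which can then be removed from both chains. The
  comparison of ranks is one-sided: a pair f, g whose composite gf agrees with s locally at P
  already yields one inequality, and the two composites of a local isomorphism yield both.
  Elimination modulo P cannot divide by a pivot; it multiplies crosswise instead, which is harmless
  because a product of elements outside a prime stays outside it.\<close>

lemma lin_mapI:
  assumes "\<And>x. x \<in> carrier M \<Longrightarrow> f x \<in> carrier N"
    and "\<And>x y. x \<in> carrier M \<Longrightarrow> y \<in> carrier M \<Longrightarrow> f (x \<oplus>\<^bsub>M\<^esub> y) = f x \<oplus>\<^bsub>N\<^esub> f y"
    and "\<And>a x. a \<in> carrier R \<Longrightarrow> x \<in> carrier M \<Longrightarrow> f (a \<odot>\<^bsub>M\<^esub> x) = a \<odot>\<^bsub>N\<^esub> f x"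
  shows "lin_map R M N f"
  using assms by (auto simp: lin_map_def)

lemma lin_mapD:
  assumes "lin_map R M N f"
  shows lin_map_closed: "x \<in> carrier M \<Longrightarrow> f x \<in> carrier N"
    and lin_map_add: "x \<in> carrier M \<Longrightarrow> y \<in> carrier M \<Longrightarrow> f (x \<oplus>\<^bsub>M\<^esub> y) = f x \<oplus>\<^bsub>N\<^esub> f y"
    and lin_map_smult: "a \<in> carrier R \<Longrightarrow> x \<in> carrier M \<Longrightarrow> f (a \<odot>\<^bsub>M\<^esub> x) = a \<odot>\<^bsub>N\<^esub> f x"
  using assms by (auto simp: lin_map_def)

lemma lin_map_comp:
  assumes "lin_map R L M f" "lin_map R M N g"
  shows "lin_map R L N (g \<circ> f)"
  using assms by (auto simp: lin_map_def Pi_def)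

lemma lin_map_zero:
  assumes "module R M" "module R N" "lin_map R M N f"
  shows "f \<zero>\<^bsub>M\<^esub> = \<zero>\<^bsub>N\<^esub>"
proof -
  interpret M: module R M by fact
  interpret N: module R N by fact
  have "f (\<zero>\<^bsub>R\<^esub> \<odot>\<^bsub>M\<^esub> \<zero>\<^bsub>M\<^esub>) = \<zero>\<^bsub>R\<^esub> \<odot>\<^bsub>N\<^esub> f \<zero>\<^bsub>M\<^esub>"
    by (rule lin_map_smult[OF assms(3)]) auto
  thus ?thesis
    using lin_map_closed[OF assms(3)] by simp
qed

lemma mod_isoI:
  assumes "lin_map R M N f" "lin_map R N M g"
    and "\<And>x. x \<in> carrier M \<Longrightarrow> g (f x) = x" "\<And>y. y \<in> carrier N \<Longrightarrow> f (g y) = y"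
  shows "mod_iso R M N"
  unfolding mod_iso_def
  by (rule exI[of _ f], intro conjI assms bij_betw_byWitness[where f' = g])
     (use assms in \<open>auto dest: lin_map_closed\<close>)

text \<open>The inverse of a linear bijection is linear as soon as sums and multiples stay in the
  carrier of \<open>M\<close>. In this form the rule serves direct sums and localizations through
  closure of their operations alone.\<close>

lemma mod_isoE_closed:
  assumes "mod_iso R M N"
    and add: "\<And>x y. x \<in> carrier M \<Longrightarrow> y \<in> carrier M \<Longrightarrow> x \<oplus>\<^bsub>M\<^esub> y \<in> carrier M"
    and smult: "\<And>a x. a \<in> carrier R \<Longrightarrow> x \<in> carrier M \<Longrightarrow> a \<odot>\<^bsub>M\<^esub> x \<in> carrier M"
  obtains f g where "lin_map R M N f" "lin_map R N M g"
    "\<And>x. x \<in> carrier M \<Longrightarrow> g (f x) = x" "\<And>y. y \<in> carrier N \<Longrightarrow> f (g y) = y"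
proof -
  obtain f where f: "lin_map R M N f" and bij: "bij_betw f (carrier M) (carrier N)"
    using assms(1) by (auto simp: mod_iso_def)
  define g where "g = the_inv_into (carrier M) f"
  have gf: "g (f x) = x" if "x \<in> carrier M" for x
    using bij that by (simp add: g_def bij_betw_def the_inv_into_f_f)
  have fg: "f (g y) = y" if "y \<in> carrier N" for y
    using bij that by (simp add: g_def f_the_inv_into_f_bij_betw)
  have gc: "g y \<in> carrier M" if "y \<in> carrier N" for y
    using bij that by (auto simp: g_def bij_betw_def intro!: the_inv_into_into)
  have "lin_map R N M g"
  proof (rule lin_mapI)
    fix x y assume xy: "x \<in> carrier N" "y \<in> carrier N"
    have "g (x \<oplus>\<^bsub>N\<^esub> y) = g (f (g x \<oplus>\<^bsub>M\<^esub> g y))"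
      using xy by (simp add: lin_map_add[OF f] fg gc)
    thus "g (x \<oplus>\<^bsub>N\<^esub> y) = g x \<oplus>\<^bsub>M\<^esub> g y"
      using xy by (simp add: gf gc add)
  next
    fix a x assume ax: "a \<in> carrier R" "x \<in> carrier N"
    have "g (a \<odot>\<^bsub>N\<^esub> x) = g (f (a \<odot>\<^bsub>M\<^esub> g x))"
      using ax by (simp add: lin_map_smult[OF f] fg gc)
    thus "g (a \<odot>\<^bsub>N\<^esub> x) = a \<odot>\<^bsub>M\<^esub> g x"
      using ax by (simp add: gf gc smult)
  qed (rule gc)
  thus thesis using that[of f g] f gf fg by blast
qed

lemma mod_isoE:
  assumes "mod_iso R M N" "module R M"
  obtains f g where "lin_map R M N f" "lin_map R N M g"
    "\<And>x. x \<in> carrier M \<Longrightarrow> g (f x) = x" "\<And>y. y \<in> carrier N \<Longrightarrow> f (g y) = y"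
proof -
  interpret module R M by fact
  show thesis by (rule mod_isoE_closed[OF assms(1)]) (use that in auto)
qed

lemma mod_iso_refl: "mod_iso R M M"
  by (rule mod_isoI[of _ _ _ id id]) (auto simp: lin_map_def)

lemma mod_iso_sym: "mod_iso R M N \<Longrightarrow> module R M \<Longrightarrow> mod_iso R N M"
  by (erule mod_isoE) (auto intro: mod_isoI)

lemma mod_iso_trans: "mod_iso R L M \<Longrightarrow> mod_iso R M N \<Longrightarrow> mod_iso R L N"
  unfolding mod_iso_def by (meson lin_map_comp bij_betw_trans)

lemma dsum_simps [simp]:
  "carrier (dsum M N) = carrier M \<times> carrier N"
  "x \<oplus>\<^bsub>dsum M N\<^esub> y = (fst x \<oplus>\<^bsub>M\<^esub> fst y, snd x \<oplus>\<^bsub>N\<^esub> snd y)"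
  "a \<odot>\<^bsub>dsum M N\<^esub> x = (a \<odot>\<^bsub>M\<^esub> fst x, a \<odot>\<^bsub>N\<^esub> snd x)"
  by (simp_all add: dsum_def)

lemma mod_iso_dsum_sym:
  assumes "module R M" "module R N" "mod_iso R (dsum M N) L"
  shows "mod_iso R L (dsum M N)"
proof -
  interpret M: module R M by fact
  interpret N: module R N by fact
  show ?thesis
    by (rule mod_isoE_closed[OF assms(3)]) (auto intro: mod_isoI)
qed

lemma mod_iso_dsum:
  assumes "mod_iso R M M'" "mod_iso R N N'"
  shows "mod_iso R (dsum M N) (dsum M' N')"
proof -
  obtain f g where "lin_map R M M' f" "bij_betw f (carrier M) (carrier M')"
    "lin_map R N N' g" "bij_betw g (carrier N) (carrier N')"
    using assms by (auto simp: mod_iso_def)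
  thus ?thesis
    unfolding mod_iso_def
    by (intro exI[of _ "map_prod f g"] conjI)
       (auto simp: lin_map_def Pi_def intro!: bij_betw_map_prod)
qed

lemma (in module) submoduleI_smult:
  assumes "H \<subseteq> carrier M" "\<zero>\<^bsub>M\<^esub> \<in> H"
    and "\<And>x y. x \<in> H \<Longrightarrow> y \<in> H \<Longrightarrow> x \<oplus>\<^bsub>M\<^esub> y \<in> H"
    and sm: "\<And>a x. a \<in> carrier R \<Longrightarrow> x \<in> H \<Longrightarrow> a \<odot>\<^bsub>M\<^esub> x \<in> H"
  shows "submodule H R M"
proof (rule submoduleI)
  fix x assume "x \<in> H"
  moreover from this have "\<ominus>\<^bsub>M\<^esub> x = (\<ominus> \<one>) \<odot>\<^bsub>M\<^esub> x"
    using assms(1) by (auto simp: smult_l_minus)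
  ultimately show "\<ominus>\<^bsub>M\<^esub> x \<in> H" by (simp add: sm)
qed (use assms in auto)

section \<open>Free modules and the modules given by lists of idempotents\<close>

lemma free_mod_simps [simp]:
  "v \<in> carrier (free_mod R n) \<longleftrightarrow> (\<forall>i<n. v i \<in> carrier R) \<and> (\<forall>i\<ge>n. v i = \<zero>\<^bsub>R\<^esub>)"
  "v \<oplus>\<^bsub>free_mod R n\<^esub> w = (\<lambda>i. v i \<oplus>\<^bsub>R\<^esub> w i)"
  "a \<odot>\<^bsub>free_mod R n\<^esub> v = (\<lambda>i. a \<otimes>\<^bsub>R\<^esub> v i)"
  "\<zero>\<^bsub>free_mod R n\<^esub> = (\<lambda>i. \<zero>\<^bsub>R\<^esub>)"
  by (simp_all add: free_mod_def)

text \<open>This is e_1 R + ... + e_k R (direct sum) inside R^k: a coordinate lies in e_i R exactly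
  when multiplication by e_i fixes it. Its carrier type is the one over which
  \<open>refinement_ring\<close> quantifies.\<close>

definition idem_mod :: "('a, 'c) ring_scheme \<Rightarrow> 'a list \<Rightarrow> ('a, nat \<Rightarrow> 'a) module"
  where "idem_mod R es = (free_mod R (length es))
    \<lparr>carrier := {v \<in> carrier (free_mod R (length es)). \<forall>i<length es. es ! i \<otimes>\<^bsub>R\<^esub> v i = v i}\<rparr>"

lemma idem_mod_simps [simp]:
  "v \<in> carrier (idem_mod R es) \<longleftrightarrow>
    (\<forall>i<length es. v i \<in> carrier R \<and> es ! i \<otimes>\<^bsub>R\<^esub> v i = v i) \<and> (\<forall>i\<ge>length es. v i = \<zero>\<^bsub>R\<^esub>)"
  "v \<oplus>\<^bsub>idem_mod R es\<^esub> w = (\<lambda>i. v i \<oplus>\<^bsub>R\<^esub> w i)"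
  "a \<odot>\<^bsub>idem_mod R es\<^esub> v = (\<lambda>i. a \<otimes>\<^bsub>R\<^esub> v i)"
  "\<zero>\<^bsub>idem_mod R es\<^esub> = (\<lambda>i. \<zero>\<^bsub>R\<^esub>)"
  by (auto simp add: idem_mod_def)

context cring
begin

lemma free_mod_coord: "v \<in> carrier (free_mod R n) \<Longrightarrow> v i \<in> carrier R"
  by (cases "i < n") auto

lemma idem_mod_coord: "v \<in> carrier (idem_mod R es) \<Longrightarrow> v i \<in> carrier R"
  by (cases "i < length es") auto

lemma module_free_mod: "module R (free_mod R n)"
proof -
  let ?F = "free_mod R n"
  note c = free_mod_coord[of _ n]
  have add: "u \<oplus>\<^bsub>?F\<^esub> v \<in> carrier ?F" if "u \<in> carrier ?F" "v \<in> carrier ?F" for u v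
    using that by simp
  have inv: "\<exists>w\<in>carrier ?F. w \<oplus>\<^bsub>?F\<^esub> v = \<zero>\<^bsub>?F\<^esub>" if "v \<in> carrier ?F" for v
    using that by (intro bexI[of _ "\<lambda>i. \<ominus> v i"]) (simp_all add: l_neg c[OF that])
  have smult: "a \<odot>\<^bsub>?F\<^esub> v \<in> carrier ?F" if "a \<in> carrier R" "v \<in> carrier ?F" for a v
    using that by simp
  show ?thesis
    by (intro moduleI abelian_groupI is_cring add inv smult)
       (simp_all only: free_mod_simps(2-4),
        simp_all add: fun_eq_iff c a_ac m_assoc l_distr r_distr del: free_mod_simps(1),
        simp)
qed

lemma module_idem_mod:
  assumes "set es \<subseteq> carrier R"
  shows "module R (idem_mod R es)"
proof -
  have es: "es ! i \<in> carrier R" if "i < length es" for i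
    using assms that by auto
  interpret F: module R "free_mod R (length es)" by (rule module_free_mod)
  show ?thesis
    unfolding idem_mod_def
    by (intro submodule.submodule_is_module[OF _ module_free_mod] F.submoduleI_smult)
       (auto simp: es r_distr m_lcomm)
qed

lemma idem_mod_replicate_one: "idem_mod R (replicate n \<one>) = free_mod R n"
proof -
  have "{v \<in> carrier (free_mod R n). \<forall>i<n. replicate n \<one> ! i \<otimes> v i = v i} = carrier (free_mod R n)"
    by auto
  thus ?thesis by (simp add: idem_mod_def free_mod_def)
qed

lemma idem_mod_Cons:
  assumes "set (e # es) \<subseteq> carrier R"
  shows "mod_iso R (dsum (idem_mod R [e]) (idem_mod R es)) (idem_mod R (e # es))"
proof (rule mod_isoI)
  let ?f = "\<lambda>p. case_nat (fst p 0) (snd p)"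
    and ?g = "\<lambda>v. (\<lambda>i. if i = 0 then v 0 else \<zero>, \<lambda>i. v (Suc i))"
  have nth: "(e # es) ! i = (case i of 0 \<Rightarrow> e | Suc j \<Rightarrow> es ! j)" for i
    by (simp add: nth_Cons)
  have c0: "e \<in> carrier R" "es ! i \<in> carrier R" if "i < length es" for i
    using assms that by auto
  show "lin_map R (dsum (idem_mod R [e]) (idem_mod R es)) (idem_mod R (e # es)) ?f"
    by (rule lin_mapI) (auto simp: fun_eq_iff nth split: nat.split)
  show "lin_map R (idem_mod R (e # es)) (dsum (idem_mod R [e]) (idem_mod R es)) ?g"
    by (rule lin_mapI) (force simp: fun_eq_iff)+
  show "?g (?f x) = x" if "x \<in> carrier (dsum (idem_mod R [e]) (idem_mod R es))" for x
    using that by (cases x) (simp add: fun_eq_iff)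
  show "?f (?g y) = y" if "y \<in> carrier (idem_mod R (e # es))" for y
    by (simp add: fun_eq_iff split: nat.split)
qed

end

subsection \<open>Decomposition into ideals generated by idempotents\<close>

definition idems :: "('a, 'c) ring_scheme \<Rightarrow> 'a set"
  where "idems R = {e \<in> carrier R. e \<otimes>\<^bsub>R\<^esub> e = e}"

lemma fg_projD: "fg_proj R M \<Longrightarrow> module R M"
  by (simp add: fg_proj_def)

context cring
begin

lemma idems_carrier: "set es \<subseteq> idems R \<Longrightarrow> set es \<subseteq> carrier R"
  by (auto simp: idems_def)

lemma fg_proj_free_mod: "fg_proj R (free_mod R n)"
  unfolding fg_proj_def using module_free_mod
  by (intro conjI exI[of _ n] exI[of _ id]) (auto simp: lin_map_def)

text \<open>The composite R \<rightarrow> Z \<rightarrow> R of projection and inclusion is linear,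
  hence multiplication by the image e of 1. It is a projection, so e is idempotent, and its image eR
  is a copy of Z.\<close>

lemma summand_of_ring:
  assumes Z: "module R Z" and Z': "module R Z'"
    and iso: "mod_iso R (dsum Z Z') (free_mod R (Suc 0))"
  shows "\<exists>e\<in>idems R. mod_iso R Z (idem_mod R [e])"
proof -
  interpret Z: module R Z by fact
  interpret Z': module R Z' by fact
  let ?F = "free_mod R (Suc 0)"
  obtain f g where f: "lin_map R (dsum Z Z') ?F f" and g: "lin_map R ?F (dsum Z Z') g"
    and gf: "\<And>x. x \<in> carrier (dsum Z Z') \<Longrightarrow> g (f x) = x"
    and fg: "\<And>y. y \<in> carrier ?F \<Longrightarrow> f (g y) = y"
    by (rule mod_isoE_closed[OF iso]) auto
  define h where "h z = f (z, \<zero>\<^bsub>Z'\<^esub>)" for z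
  define k where "k v = fst (g v)" for v
  have h: "lin_map R Z ?F h"
  proof (rule lin_mapI)
    show "h x \<in> carrier ?F" if "x \<in> carrier Z" for x
      unfolding h_def using that by (intro lin_map_closed[OF f]) simp
    show "h (x \<oplus>\<^bsub>Z\<^esub> y) = h x \<oplus>\<^bsub>?F\<^esub> h y" if "x \<in> carrier Z" "y \<in> carrier Z" for x y
      using lin_map_add[OF f, of "(x, \<zero>\<^bsub>Z'\<^esub>)" "(y, \<zero>\<^bsub>Z'\<^esub>)"] that by (simp add: h_def)
    show "h (a \<odot>\<^bsub>Z\<^esub> x) = a \<odot>\<^bsub>?F\<^esub> h x" if "a \<in> carrier R" "x \<in> carrier Z" for a x
      using lin_map_smult[OF f, of a "(x, \<zero>\<^bsub>Z'\<^esub>)"] that by (simp add: h_def)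
  qed
  have k: "lin_map R ?F Z k"
    using g unfolding lin_map_def k_def by (auto simp: Pi_def mem_Times_iff)
  have kh: "k (h z) = z" if "z \<in> carrier Z" for z
    using that by (simp add: k_def h_def gf)
  define b :: "nat \<Rightarrow> 'a" where "b = (\<lambda>i. if i = 0 then \<one> else \<zero>)"
  have b: "b \<in> carrier ?F" by (simp add: b_def)
  define e where "e = h (k b) 0"
  have hkb: "h (k b) \<in> carrier ?F"
    by (intro lin_map_closed[OF h] lin_map_closed[OF k] b)
  hence e: "e \<in> carrier R" by (simp add: e_def)
  have hk: "h (k v) 0 = v 0 \<otimes> e" if v: "v \<in> carrier ?F" for v
  proof -
    have v0: "v 0 \<in> carrier R" using v by simp
    have "v = v 0 \<odot>\<^bsub>?F\<^esub> b"
      using v by (auto simp: fun_eq_iff b_def)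
    hence "h (k v) = h (k (v 0 \<odot>\<^bsub>?F\<^esub> b))"
      by simp
    also have "\<dots> = v 0 \<odot>\<^bsub>?F\<^esub> h (k b)"
      using v0 b by (simp add: lin_map_smult[OF k] lin_map_smult[OF h] lin_map_closed[OF k]
          del: free_mod_simps)
    finally have "h (k v) 0 = (v 0 \<odot>\<^bsub>?F\<^esub> h (k b)) 0"
      by (rule fun_cong)
    thus ?thesis by (simp add: e_def)
  qed
  have "e \<otimes> e = e"
    using hk[OF hkb] by (simp add: kh lin_map_closed[OF k b] flip: e_def)
  have "mod_iso R Z (idem_mod R [e])"
  proof (rule mod_isoI)
    have sub: "v \<in> carrier ?F" if "v \<in> carrier (idem_mod R [e])" for v
      using that by simp
    show "lin_map R Z (idem_mod R [e]) h"
    proof (rule lin_mapI)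
      show "h z \<in> carrier (idem_mod R [e])" if z: "z \<in> carrier Z" for z
      proof -
        have "h z \<in> carrier ?F" by (rule lin_map_closed[OF h z])
        moreover from hk[OF this] have "h z 0 = h z 0 \<otimes> e" by (simp add: kh z)
        ultimately show ?thesis using e by (simp add: m_comm)
      qed
    qed (simp_all add: lin_map_add[OF h] lin_map_smult[OF h])
    show "lin_map R (idem_mod R [e]) Z k"
      by (rule lin_mapI)
         (use sub lin_map_closed[OF k] lin_map_add[OF k] lin_map_smult[OF k] in \<open>simp_all del: idem_mod_simps(1) free_mod_simps(1)\<close>)
    show "h (k v) = v" if v: "v \<in> carrier (idem_mod R [e])" for v
    proof
      fix i
      have "h (k v) \<in> carrier ?F"
        by (intro lin_map_closed[OF h] lin_map_closed[OF k] sub v)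
      thus "h (k v) i = v i"
        using hk[OF sub[OF v]] v e by (cases "i = 0") (auto simp: m_comm)
    qed
  qed (rule kh)
  thus ?thesis using e \<open>e \<otimes> e = e\<close> by (auto simp: idems_def)
qed

text \<open>Refining X + X' = R + R^n writes X as Z11 + Z12, where Z11 is a summand of R and Z12 is
  a summand of R^n with complement Z22. The first is generated by an idempotent, the second falls to
  the induction hypothesis.\<close>

lemma refinement_idem_mod_aux:
  fixes X X' :: "('a, nat \<Rightarrow> 'a) module"
  assumes "refinement_ring R"
  shows "fg_proj R X \<Longrightarrow> fg_proj R X' \<Longrightarrow> mod_iso R (dsum X X') (free_mod R n) \<Longrightarrow>
    \<exists>es. set es \<subseteq> idems R \<and> mod_iso R X (idem_mod R es)"
proof (induction n arbitrary: X X')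
  case 0
  interpret X: module R X by (rule fg_projD) fact
  interpret X': module R X' by (rule fg_projD) fact
  obtain f where f: "lin_map R (dsum X X') (free_mod R 0) f"
    and inj: "inj_on f (carrier (dsum X X'))"
    using 0 by (auto simp: mod_iso_def bij_betw_def)
  have triv: "x = \<zero>\<^bsub>X\<^esub>" if x: "x \<in> carrier X" for x
  proof -
    have "f (x, \<zero>\<^bsub>X'\<^esub>) = f (\<zero>\<^bsub>X\<^esub>, \<zero>\<^bsub>X'\<^esub>)"
      using lin_map_closed[OF f, of "(x, \<zero>\<^bsub>X'\<^esub>)"] lin_map_closed[OF f, of "(\<zero>\<^bsub>X\<^esub>, \<zero>\<^bsub>X'\<^esub>)"] x
      by (simp add: fun_eq_iff)
    thus ?thesis
      using inj_onD[OF inj, of "(x, \<zero>\<^bsub>X'\<^esub>)" "(\<zero>\<^bsub>X\<^esub>, \<zero>\<^bsub>X'\<^esub>)"] x by simp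
  qed
  have "mod_iso R X (idem_mod R [])"
    by (rule mod_isoI[where f = "\<lambda>_ _. \<zero>" and g = "\<lambda>_. \<zero>\<^bsub>X\<^esub>"])
       (auto simp: lin_map_def fun_eq_iff dest: triv)
  thus ?case by (intro exI[of _ "[]"]) auto
next
  case (Suc n)
  note X = fg_projD[OF Suc.prems(1)] and X' = fg_projD[OF Suc.prems(2)]
  interpret X: module R X by (rule X)
  interpret X': module R X' by (rule X')
  \<comment> \<open>The splitting R^(n+1) = R + R^n is the case of a list consisting of
    ones.\<close>
  have "mod_iso R (dsum (free_mod R (Suc 0)) (free_mod R n)) (free_mod R (Suc n))"
    using idem_mod_Cons[of \<one> "replicate n \<one>"] idem_mod_replicate_one[of "Suc 0"]
      idem_mod_replicate_one[of n] idem_mod_replicate_one[of "Suc n"]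
    by (simp add: set_replicate_conv_if)
  moreover have "mod_iso R (free_mod R (Suc n)) (dsum (free_mod R (Suc 0)) (free_mod R n))"
    by (rule mod_iso_dsum_sym[OF module_free_mod module_free_mod calculation])
  ultimately have "mod_iso R (dsum X X') (dsum (free_mod R (Suc 0)) (free_mod R n))"
    using Suc.prems(3) mod_iso_trans by blast
  then obtain Z11 Z12 Z21 Z22 :: "('a, nat \<Rightarrow> 'a) module"
    where Z: "fg_proj R Z11" "fg_proj R Z12" "fg_proj R Z21" "fg_proj R Z22"
      and X_eq: "mod_iso R X (dsum Z11 Z12)"
      and F: "mod_iso R (free_mod R (Suc 0)) (dsum Z11 Z21)" "mod_iso R (free_mod R n) (dsum Z12 Z22)"
    using assms[unfolded refinement_ring_def, rule_format, of X X' "free_mod R (Suc 0)" "free_mod R n"]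
      Suc.prems(1,2) fg_proj_free_mod by blast
  obtain e where e: "e \<in> idems R" "mod_iso R Z11 (idem_mod R [e])"
    using summand_of_ring[OF fg_projD[OF Z(1)] fg_projD[OF Z(3)] mod_iso_sym[OF F(1) module_free_mod]]
    by blast
  obtain es where es: "set es \<subseteq> idems R" "mod_iso R Z12 (idem_mod R es)"
    using Suc.IH[OF Z(2,4) mod_iso_sym[OF F(2) module_free_mod]] by blast
  have "mod_iso R X (idem_mod R (e # es))"
    using mod_iso_trans[OF X_eq mod_iso_trans[OF mod_iso_dsum[OF e(2) es(2)] idem_mod_Cons]]
      e(1) es(1) by (simp add: idems_carrier) (auto simp: idems_def)
  thus ?case using e(1) es(1) by (intro exI[of _ "e # es"]) auto
qed

text \<open>With p after i the identity, R^n splits into the image of i, a copy of \<open>M\<close>,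
  and the kernel of p. Both are submodules of R^n and thus have the carrier type that refinement
  requires.\<close>

lemma fg_proj_idem_mod:
  assumes "refinement_ring R" "fg_proj R M"
  shows "\<exists>es. set es \<subseteq> idems R \<and> mod_iso R M (idem_mod R es)"
proof -
  obtain n i p where i: "lin_map R M (free_mod R n) i" and p: "lin_map R (free_mod R n) M p"
    and pi: "\<And>x. x \<in> carrier M \<Longrightarrow> p (i x) = x"
    using assms(2) unfolding fg_proj_def by blast
  define F where "F = free_mod R n"
  note i = i[folded F_def] and p = p[folded F_def]
  have F: "module R F" unfolding F_def by (rule module_free_mod)
  interpret M: module R M by (rule fg_projD) fact
  interpret F: module R F by (rule F)
  note pc = lin_map_closed[OF p] and ic = lin_map_closed[OF i]
  define X where "X = F\<lparr>carrier := i ` carrier M\<rparr>"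
  define X' where "X' = F\<lparr>carrier := {v \<in> carrier F. p v = \<zero>\<^bsub>M\<^esub>}\<rparr>"
  have X_simps: "carrier X = i ` carrier M" "add X = add F" "smult X = smult F"
    and X'_simps: "carrier X' = {v \<in> carrier F. p v = \<zero>\<^bsub>M\<^esub>}" "add X' = add F" "smult X' = smult F"
    by (simp_all add: X_def X'_def)
  \<comment> \<open>\<open>q\<close> and \<open>c\<close> are the complementary projections ip and 1
    - ip of R^n, onto the image of i and the kernel of p. They witness that both pieces are
    projective and together invert the addition map.\<close>
  define q where "q v = i (p v)" for v
  define c where "c v = v \<oplus>\<^bsub>F\<^esub> (\<ominus> \<one>) \<odot>\<^bsub>F\<^esub> q v" for v
  have q: "lin_map R F F q"
    using lin_map_comp[OF p i] by (simp add: q_def[abs_def] comp_def)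
  note qc = lin_map_closed[OF q]
  have cc: "c v \<in> carrier F" if "v \<in> carrier F" for v
    using that by (simp add: c_def qc)
  have c: "lin_map R F F c"
    by (rule lin_mapI)
       (auto simp: c_def qc lin_map_add[OF q] lin_map_smult[OF q] F.smult_r_distr F.a_ac m_comm
             simp flip: F.smult_assoc1)
  have pc0: "p (c v) = \<zero>\<^bsub>M\<^esub>" if v: "v \<in> carrier F" for v
  proof -
    have "p (c v) = p v \<oplus>\<^bsub>M\<^esub> (\<ominus> \<one>) \<odot>\<^bsub>M\<^esub> p (q v)"
      using v by (simp add: c_def lin_map_add[OF p] lin_map_smult[OF p] qc)
    thus ?thesis
      using v by (simp add: q_def pi pc M.smult_l_minus M.r_neg)
  qed
  have "mod_iso R M X"
    by (rule mod_isoI[of _ _ _ i p])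
       (auto simp: lin_map_def X_simps lin_map_add[OF i] lin_map_smult[OF i] pi
          lin_map_add[OF p] lin_map_smult[OF p] ic)
  have X_mod: "module R X"
    unfolding X_def
  proof (rule submodule.submodule_is_module[OF _ F], rule F.submoduleI_smult)
    have "\<zero>\<^bsub>F\<^esub> = i \<zero>\<^bsub>M\<^esub>"
      by (rule lin_map_zero[symmetric, OF fg_projD[OF assms(2)] F i])
    thus "\<zero>\<^bsub>F\<^esub> \<in> i ` carrier M" by blast
  qed (auto simp: ic simp flip: lin_map_add[OF i] lin_map_smult[OF i])
  have X'_mod: "module R X'"
    unfolding X'_def
    by (rule submodule.submodule_is_module[OF _ F], rule F.submoduleI_smult)
       (auto simp: lin_map_add[OF p] lin_map_smult[OF p] lin_map_zero[OF F fg_projD[OF assms(2)] p])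
  have "fg_proj R X"
    unfolding fg_proj_def
    by (rule conjI[OF X_mod], intro exI[of _ n] exI[of _ id] exI[of _ q])
       (use q in \<open>auto simp: F_def[symmetric] lin_map_def X_simps q_def pi ic Pi_def pc\<close>)
  moreover have "c x = x" if "x \<in> carrier F" "p x = \<zero>\<^bsub>M\<^esub>" for x
    using that lin_map_zero[OF fg_projD[OF assms(2)] F i] by (simp add: c_def q_def)
  hence "fg_proj R X'"
    unfolding fg_proj_def
    by (intro conjI X'_mod exI[of _ n] exI[of _ id] exI[of _ c])
       (use c in \<open>auto simp: F_def[symmetric] lin_map_def X'_simps pc0 Pi_def\<close>)
  moreover have "mod_iso R (dsum X X') (free_mod R n)"
    unfolding F_def[symmetric]
  proof (rule mod_isoI)
    show "lin_map R (dsum X X') F (\<lambda>(u, w). u \<oplus>\<^bsub>F\<^esub> w)"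
      by (rule lin_mapI) (auto simp: X_simps X'_simps ic F.a_ac F.smult_r_distr)
    show "lin_map R F (dsum X X') (\<lambda>v. (q v, c v))"
      by (rule lin_mapI)
         (auto simp: X_simps X'_simps pc0 cc q_def pc lin_map_add[OF c] lin_map_smult[OF c]
            lin_map_add[OF p] lin_map_smult[OF p] lin_map_add[OF i] lin_map_smult[OF i])
    fix v assume v: "v \<in> carrier F"
    have "q v \<oplus>\<^bsub>F\<^esub> (v \<oplus>\<^bsub>F\<^esub> \<ominus>\<^bsub>F\<^esub> q v) = v \<oplus>\<^bsub>F\<^esub> (q v \<oplus>\<^bsub>F\<^esub> \<ominus>\<^bsub>F\<^esub> q v)"
      using v qc[OF v] by (intro F.a_lcomm) auto
    thus "(case (q v, c v) of (u, w) \<Rightarrow> u \<oplus>\<^bsub>F\<^esub> w) = v"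
      using v qc[OF v] by (simp add: c_def F.smult_l_minus F.r_neg)
  next
    fix x assume "x \<in> carrier (dsum X X')"
    then obtain m w where x: "x = (i m, w)" and m: "m \<in> carrier M"
      and w: "w \<in> carrier F" "p w = \<zero>\<^bsub>M\<^esub>"
      by (auto simp: X_simps X'_simps)
    have q: "q (i m \<oplus>\<^bsub>F\<^esub> w) = i m"
      using m w by (simp add: q_def lin_map_add[OF p] ic pi)
    have "i m \<oplus>\<^bsub>F\<^esub> w \<oplus>\<^bsub>F\<^esub> \<ominus>\<^bsub>F\<^esub> i m = w \<oplus>\<^bsub>F\<^esub> (i m \<oplus>\<^bsub>F\<^esub> \<ominus>\<^bsub>F\<^esub> i m)"
      using ic[OF m] w by (simp add: F.a_ac)
    thus "(\<lambda>v. (q v, c v)) (case x of (u, w) \<Rightarrow> u \<oplus>\<^bsub>F\<^esub> w) = x"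
      using ic[OF m] w by (simp add: x q c_def F.smult_l_minus F.r_neg)
  qed
  ultimately obtain es where "set es \<subseteq> idems R" "mod_iso R X (idem_mod R es)"
    using refinement_idem_mod_aux[OF assms(1)] by blast
  with \<open>mod_iso R M X\<close> show ?thesis using mod_iso_trans by blast
qed

end

subsection \<open>Descending chains of idempotents\<close>

text \<open>The relation ef = f says that f lies below e in the order of idempotents, that is, fR is
  contained in eR.\<close>

definition idem_chain :: "('a, 'c) ring_scheme \<Rightarrow> 'a list \<Rightarrow> bool"
  where "idem_chain R es \<longleftrightarrow> set es \<subseteq> idems R \<and> sorted_wrt (\<lambda>e f. e \<otimes>\<^bsub>R\<^esub> f = f) es"

context cring
begin

lemma idem_mod_Cons_cong:
  assumes "set (e # es) \<subseteq> idems R" "set fs \<subseteq> idems R"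
    and "mod_iso R (idem_mod R es) (idem_mod R fs)"
  shows "mod_iso R (idem_mod R (e # es)) (idem_mod R (e # fs))"
proof -
  have c: "set (e # es) \<subseteq> carrier R" "set (e # fs) \<subseteq> carrier R"
    using assms(1,2) by (auto simp: idems_def)
  have "mod_iso R (idem_mod R (e # es)) (dsum (idem_mod R [e]) (idem_mod R es))"
    by (intro mod_iso_dsum_sym module_idem_mod idem_mod_Cons) (use c in auto)
  from mod_iso_trans[OF mod_iso_trans[OF this mod_iso_dsum[OF mod_iso_refl assms(3)]] idem_mod_Cons[OF c(2)]]
  show ?thesis .
qed

text \<open>Put d = 1 - e. Then fR is the sum of efR and dfR, and dfR is orthogonal to eR, so eR and
  dfR together form (e + df)R. Here e + df = e + f - ef is the join of e and f.\<close>

lemma idem_mod_join_meet: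
  assumes e: "e \<in> idems R" and f: "f \<in> idems R" and fs: "set fs \<subseteq> idems R"
  shows "mod_iso R (idem_mod R (e # f # fs)) (idem_mod R ((e \<oplus> (\<one> \<ominus> e) \<otimes> f) # (e \<otimes> f) # fs))"
proof -
  define d where "d = \<one> \<ominus> e"
  have c [simp]: "e \<in> carrier R" "f \<in> carrier R" "d \<in> carrier R"
    using e f by (auto simp: idems_def d_def)
  have ee: "e \<otimes> e = e" and ff: "f \<otimes> f = f"
    using e f by (auto simp: idems_def)
  have ed: "e \<otimes> d = \<zero>" "d \<otimes> e = \<zero>"
    using ee by (simp_all add: d_def minus_eq r_distr l_distr r_minus l_minus r_neg)
  have ed1: "e \<oplus> d = \<one>"
    by (simp add: d_def minus_eq a_lcomm[of e] r_neg)
  have dd: "d \<otimes> d = d"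
    using l_distr[of e d d] ed by (simp add: ed1)
  have ee': "e \<otimes> (e \<otimes> x) = e \<otimes> x" and ff': "f \<otimes> (f \<otimes> x) = f \<otimes> x" and dd': "d \<otimes> (d \<otimes> x) = d \<otimes> x"
    and ed': "e \<otimes> (d \<otimes> x) = \<zero>" "d \<otimes> (e \<otimes> x) = \<zero>"
    if "x \<in> carrier R" for x
    using that by (simp_all add: ee ff dd ed flip: m_assoc)
  have e_d: "e \<otimes> x \<oplus> d \<otimes> x = x" if "x \<in> carrier R" for x
    using l_distr[of e d x] that by (simp add: ed1)
  have d_e: "d \<otimes> x \<oplus> e \<otimes> x = x" if "x \<in> carrier R" for x
    using e_d[OF that] that by (simp add: a_comm)
  note rules = r_distr l_distr m_assoc ee ff dd ed ee' ff' dd' ed'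
  let ?es = "e # f # fs" and ?es' = "(e \<oplus> d \<otimes> f) # (e \<otimes> f) # fs"
  \<comment> \<open>\<open>?u\<close> moves the d-part of coordinate 1 into coordinate 0 and leaves
    its e-part behind; \<open>?w\<close> moves the d-part back. Coordinates from 2 on are
    untouched.\<close>
  let ?u = "\<lambda>v i. if i = 0 then v 0 \<oplus> d \<otimes> v 1 else if i = 1 then e \<otimes> v 1 else v i"
    and ?w = "\<lambda>v i. if i = 0 then e \<otimes> v 0 else if i = 1 then d \<otimes> v 0 \<oplus> v 1 else v i"
  have nth_es: "?es ! i = (if i = 0 then e else if i = 1 then f else fs ! (i - 2))"
    and nth_es': "?es' ! i = (if i = 0 then e \<oplus> d \<otimes> f else if i = 1 then e \<otimes> f else fs ! (i - 2))" for i
    by (auto simp: nth_Cons split: nat.splits)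
  have D: "v 0 \<in> carrier R" "v (Suc 0) \<in> carrier R" "e \<otimes> v 0 = v 0" "f \<otimes> v (Suc 0) = v (Suc 0)"
    if "v \<in> carrier (idem_mod R ?es)" for v
    using that by (auto simp: nth_es)
  have D': "v 0 \<in> carrier R" "v (Suc 0) \<in> carrier R" "d \<otimes> (f \<otimes> v 0) = d \<otimes> v 0"
    "e \<otimes> v (Suc 0) = v (Suc 0)" "f \<otimes> v (Suc 0) = v (Suc 0)" "d \<otimes> v (Suc 0) = \<zero>"
    if v: "v \<in> carrier (idem_mod R ?es')" for v
  proof -
    show v0: "v 0 \<in> carrier R" and v1: "v (Suc 0) \<in> carrier R"
      using v by auto
    have 0: "(e \<oplus> d \<otimes> f) \<otimes> v 0 = v 0" and 1: "(e \<otimes> f) \<otimes> v (Suc 0) = v (Suc 0)"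
      using v by (auto simp: nth_es')
    show "d \<otimes> (f \<otimes> v 0) = d \<otimes> v 0"
      using arg_cong[OF 0, of "(\<otimes>) d"] v0 by (simp add: rules)
    have "e \<otimes> ((e \<otimes> f) \<otimes> v (Suc 0)) = (e \<otimes> f) \<otimes> v (Suc 0)"
      "f \<otimes> ((e \<otimes> f) \<otimes> v (Suc 0)) = (e \<otimes> f) \<otimes> v (Suc 0)"
      using v1 by (simp_all add: rules m_lcomm[of f e])
    thus e1: "e \<otimes> v (Suc 0) = v (Suc 0)" and "f \<otimes> v (Suc 0) = v (Suc 0)"
      unfolding 1 by simp_all
    show "d \<otimes> v (Suc 0) = \<zero>"
      using arg_cong[OF e1, of "(\<otimes>) d"] v1 by (simp add: rules)
  qed
  have "mod_iso R (idem_mod R ?es) (idem_mod R ?es')"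
  proof (rule mod_isoI)
    have f_d: "f \<otimes> (d \<otimes> x) = d \<otimes> (f \<otimes> x)" "f \<otimes> (e \<otimes> x) = e \<otimes> (f \<otimes> x)"
      if "x \<in> carrier R" for x using that by (simp_all add: m_lcomm)
    have d0: "d \<otimes> v 0 = \<zero>" if "v \<in> carrier (idem_mod R ?es)" for v
      using ed'(2)[of "v 0"] D[OF that] by simp
    show "lin_map R (idem_mod R ?es) (idem_mod R ?es') ?u"
    proof (rule lin_mapI)
      fix v assume v: "v \<in> carrier (idem_mod R ?es)"
      note D = D[OF v]
      have rest: "fs ! (i - 2) \<otimes> v i = v i" if "i \<noteq> 0" "i \<noteq> Suc 0" "i < Suc (Suc (length fs))" for i
      proof -
        have "?es ! i \<otimes> v i = v i" using v that by (simp only: idem_mod_simps list.size; simp)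
        thus ?thesis using that by (simp only: nth_es nth_es'; simp)
      qed
      have "(e \<oplus> d \<otimes> f) \<otimes> v 0 = v 0"
        using D d0[OF v] by (simp add: l_distr m_assoc m_lcomm[of d f])
      moreover have "(e \<oplus> d \<otimes> f) \<otimes> (d \<otimes> v (Suc 0)) = d \<otimes> v (Suc 0)"
        using D by (simp add: l_distr m_assoc ed' dd' m_lcomm[of f d])
      ultimately have "(e \<oplus> d \<otimes> f) \<otimes> (v 0 \<oplus> d \<otimes> v (Suc 0)) = v 0 \<oplus> d \<otimes> v (Suc 0)"
        using D by (simp add: r_distr)
      moreover have "(e \<otimes> f) \<otimes> (e \<otimes> v (Suc 0)) = e \<otimes> v (Suc 0)"
        using D by (simp add: rules f_d)
      ultimately show "?u v \<in> carrier (idem_mod R ?es')"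
        using v D by (auto simp: nth_es' rest)
    next
      show "?u (x \<oplus>\<^bsub>idem_mod R ?es\<^esub> y) = ?u x \<oplus>\<^bsub>idem_mod R ?es'\<^esub> ?u y"
        if "x \<in> carrier (idem_mod R ?es)" "y \<in> carrier (idem_mod R ?es)" for x y
        using D(1,2)[OF that(1)] D(1,2)[OF that(2)] by (simp add: fun_eq_iff r_distr a_ac)
      show "?u (a \<odot>\<^bsub>idem_mod R ?es\<^esub> x) = a \<odot>\<^bsub>idem_mod R ?es'\<^esub> ?u x"
        if "a \<in> carrier R" "x \<in> carrier (idem_mod R ?es)" for a x
        using that(1) D(1,2)[OF that(2)] by (simp add: fun_eq_iff r_distr m_lcomm)
    qed
    show "lin_map R (idem_mod R ?es') (idem_mod R ?es) ?w"
    proof (rule lin_mapI)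
      fix v assume v: "v \<in> carrier (idem_mod R ?es')"
      note D = D'[OF v]
      have rest: "fs ! (i - 2) \<otimes> v i = v i" if "i \<noteq> 0" "i \<noteq> Suc 0" "i < Suc (Suc (length fs))" for i
      proof -
        have "?es' ! i \<otimes> v i = v i" using v that by (simp only: idem_mod_simps list.size; simp)
        thus ?thesis using that by (simp only: nth_es nth_es'; simp)
      qed
      have "f \<otimes> (d \<otimes> v 0 \<oplus> v (Suc 0)) = d \<otimes> v 0 \<oplus> v (Suc 0)"
        using D by (simp add: rules f_d)
      thus "?w v \<in> carrier (idem_mod R ?es)"
        using v D by (auto simp: nth_es rest ee')
    next
      show "?w (x \<oplus>\<^bsub>idem_mod R ?es'\<^esub> y) = ?w x \<oplus>\<^bsub>idem_mod R ?es\<^esub> ?w y"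
        if "x \<in> carrier (idem_mod R ?es')" "y \<in> carrier (idem_mod R ?es')" for x y
        using D'(1,2)[OF that(1)] D'(1,2)[OF that(2)] by (simp add: fun_eq_iff r_distr a_ac)
      show "?w (a \<odot>\<^bsub>idem_mod R ?es'\<^esub> x) = a \<odot>\<^bsub>idem_mod R ?es\<^esub> ?w x"
        if "a \<in> carrier R" "x \<in> carrier (idem_mod R ?es')" for a x
        using that(1) D'(1,2)[OF that(2)] by (simp add: fun_eq_iff r_distr m_lcomm)
    qed
    show "?w (?u v) = v" if v: "v \<in> carrier (idem_mod R ?es)" for v
      using D[OF v] d0[OF v] by (simp add: fun_eq_iff r_distr ed' dd' d_e)
    show "?u (?w v) = v" if v: "v \<in> carrier (idem_mod R ?es')" for v
      using D'[OF v] by (simp add: fun_eq_iff r_distr ed' ee' dd' e_d)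
  qed
  thus ?thesis by (simp add: d_def)
qed

text \<open>The head f becomes the join of e and f, and their meet ef is inserted into the tail. The
  last conjunct says that common upper bounds of e and the chain still bound the result; it
  strengthens the induction so that the join is known to dominate the new tail.\<close>

lemma idem_chain_insert:
  assumes "e \<in> idems R" "idem_chain R fs"
  shows "\<exists>gs. idem_chain R gs \<and> mod_iso R (idem_mod R (e # fs)) (idem_mod R gs) \<and>
    (\<forall>g\<in>carrier R. g \<otimes> e = e \<longrightarrow> (\<forall>f\<in>set fs. g \<otimes> f = f) \<longrightarrow> (\<forall>x\<in>set gs. g \<otimes> x = x))"
  using assms
proof (induction fs arbitrary: e)
  case Nil
  thus ?case
    by (intro exI[of _ "[e]"]) (auto simp: idem_chain_def mod_iso_refl)
next
  case (Cons f fs)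
  have c [simp]: "e \<in> carrier R" "f \<in> carrier R"
    using Cons.prems by (auto simp: idem_chain_def idems_def)
  have ee: "e \<otimes> e = e" and ff: "f \<otimes> f = f" and fs: "idem_chain R fs" "set fs \<subseteq> idems R" "set fs \<subseteq> carrier R"
    and f_fs: "\<And>f'. f' \<in> set fs \<Longrightarrow> f \<otimes> f' = f'"
    using Cons.prems by (auto simp: idem_chain_def idems_def)
  define d where "d = \<one> \<ominus> e"
  have d [simp]: "d \<in> carrier R" by (simp add: d_def)
  define j where "j = e \<oplus> d \<otimes> f"
  have j [simp]: "j \<in> carrier R" by (simp add: j_def)
  have de: "d \<otimes> e = \<zero>"
    using ee by (simp add: d_def minus_eq l_distr l_minus r_neg)
  have ed1: "e \<oplus> d = \<one>"
    by (simp add: d_def minus_eq a_lcomm[of e] r_neg)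
  have je: "j \<otimes> e = e"
    by (simp add: j_def l_distr ee m_assoc m_comm[of f e])
       (simp add: de flip: m_assoc)
  have jf: "j \<otimes> f = f"
    using l_distr[of e d f] by (simp add: j_def l_distr m_assoc ff ed1)
  have "j \<otimes> j = j \<otimes> e \<oplus> d \<otimes> (j \<otimes> f)"
    by (simp add: j_def r_distr m_lcomm[of d])
  hence jj: "j \<otimes> j = j" by (simp add: je jf) (simp add: j_def)
  have m: "e \<otimes> f \<in> idems R"
    by (simp add: idems_def m_ac ee ff) (simp add: ee ff m_lcomm[of e f] flip: m_assoc)
  obtain gs where gs: "idem_chain R gs" "mod_iso R (idem_mod R ((e \<otimes> f) # fs)) (idem_mod R gs)"
    and bound: "\<And>g x. g \<in> carrier R \<Longrightarrow> g \<otimes> (e \<otimes> f) = e \<otimes> f \<Longrightarrow> (\<And>f. f \<in> set fs \<Longrightarrow> g \<otimes> f = f) \<Longrightarrow>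
      x \<in> set gs \<Longrightarrow> g \<otimes> x = x"
    using Cons.IH[OF m fs(1)] by blast
  have "mod_iso R (idem_mod R (e # f # fs)) (idem_mod R (j # (e \<otimes> f) # fs))"
    unfolding j_def d_def
    by (rule idem_mod_join_meet) (use Cons.prems fs in \<open>auto simp: idem_chain_def\<close>)
  moreover have "mod_iso R (idem_mod R (j # (e \<otimes> f) # fs)) (idem_mod R (j # gs))"
    by (rule idem_mod_Cons_cong) (use m gs fs jj in \<open>auto simp: idem_chain_def idems_def\<close>)
  moreover have "j \<otimes> f' = f'" if "f' \<in> set fs" for f'
  proof -
    have "f' \<in> carrier R" using that fs by auto
    hence "j \<otimes> (f \<otimes> f') = f \<otimes> f'" by (simp add: jf flip: m_assoc)
    thus ?thesis by (simp add: f_fs that)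
  qed
  \<comment> \<open>The join \<open>j\<close> bounds ef and all of \<open>fs\<close>, hence by
    \<open>bound\<close> everything in \<open>gs\<close>.\<close>
  hence "idem_chain R (j # gs)"
    using gs(1) bound[of j] jj by (auto simp: idem_chain_def idems_def je simp flip: m_assoc)
  moreover have "g \<otimes> x = x"
    if g: "g \<in> carrier R" "g \<otimes> e = e" "\<forall>f'\<in>set (f # fs). g \<otimes> f' = f'" and x: "x \<in> set (j # gs)" for g x
  proof -
    have "g \<otimes> j = g \<otimes> e \<oplus> d \<otimes> (g \<otimes> f)"
      using g(1) by (simp add: j_def r_distr m_lcomm[of d])
    hence "g \<otimes> j = j" using g by (simp add: j_def)
    moreover have "g \<otimes> (e \<otimes> f) = e \<otimes> f"
      using g by (simp flip: m_assoc)
    ultimately show ?thesis using bound[of g x] g x by auto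
  qed
  ultimately show ?case using mod_iso_trans by blast
qed

lemma idem_chain_exists:
  assumes "set es \<subseteq> idems R"
  shows "\<exists>fs. idem_chain R fs \<and> mod_iso R (idem_mod R es) (idem_mod R fs)"
  using assms
proof (induction es)
  case Nil
  thus ?case by (intro exI[of _ "[]"]) (auto simp: idem_chain_def mod_iso_refl)
next
  case (Cons e es)
  then obtain fs where fs: "idem_chain R fs" "mod_iso R (idem_mod R es) (idem_mod R fs)"
    by auto
  from fs have "mod_iso R (idem_mod R (e # es)) (idem_mod R (e # fs))"
    by (intro idem_mod_Cons_cong Cons.prems) (auto simp: idem_chain_def)
  moreover obtain gs where "idem_chain R gs" "mod_iso R (idem_mod R (e # fs)) (idem_mod R gs)"
    using idem_chain_insert[OF _ fs(1)] Cons.prems by force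
  ultimately show ?case using mod_iso_trans by blast
qed

end

subsection \<open>Ranks at prime ideals\<close>

text \<open>At a prime P an idempotent e becomes 1 or 0: since e(1 - e) = 0, whichever of e and 1 -
  e lies outside P is a denominator annihilating the other. Thus eR contributes R_P or 0 to the
  localization, and the count is its rank.\<close>

definition idem_rank :: "'a set \<Rightarrow> 'a list \<Rightarrow> nat"
  where "idem_rank P es = length (filter (\<lambda>e. e \<notin> P) es)"

lemma idem_rank_simps [simp]:
  "idem_rank P [] = 0"
  "idem_rank P (e # es) = (if e \<in> P then idem_rank P es else Suc (idem_rank P es))"
  by (simp_all add: idem_rank_def)

lemma idem_rank_eq_0: "idem_rank P es = 0 \<longleftrightarrow> set es \<subseteq> P"
  by (auto simp: idem_rank_def filter_empty_conv)

lemma idem_rank_eq_card: "idem_rank P es = card {i. i < length es \<and> es ! i \<notin> P}"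
  by (simp add: idem_rank_def length_filter_conv_card)

context cring
begin

lemma exists_primeideal_containing:
  assumes I: "ideal I R" and "\<one> \<notin> I"
  shows "\<exists>P. primeideal P R \<and> I \<subseteq> P"
proof -
  define S where "S = {J. ideal J R \<and> I \<subseteq> J \<and> \<one> \<notin> J}"
  have "\<exists>P\<in>S. \<forall>J\<in>S. P \<subseteq> J \<longrightarrow> J = P"
  proof (rule subset_Zorn)
    fix C assume C: "subset.chain S C"
    show "\<exists>U\<in>S. \<forall>J\<in>C. J \<subseteq> U"
    proof (cases "C = {}")
      case True
      thus ?thesis using assms by (auto simp: S_def)
    next
      case False
      have "subset.chain {I. ideal I R} C"
        using C by (auto simp: pred_on.chain_def S_def)
      from chain_Union_is_ideal[OF this] have "ideal (\<Union>C) R"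
        using False by simp
      moreover have "I \<subseteq> \<Union>C" "\<one> \<notin> \<Union>C"
        using C False unfolding pred_on.chain_def S_def by blast+
      ultimately show ?thesis by (intro bexI[of _ "\<Union>C"]) (auto simp: S_def)
    qed
  qed
  then obtain P where P: "ideal P R" "I \<subseteq> P" "\<one> \<notin> P"
    and max: "\<And>J. ideal J R \<Longrightarrow> I \<subseteq> J \<Longrightarrow> \<one> \<notin> J \<Longrightarrow> P \<subseteq> J \<Longrightarrow> J = P"
    by (auto simp: S_def)
  have "maximalideal P R"
  proof (rule maximalidealI)
    fix J assume J: "ideal J R" "P \<subseteq> J" "J \<subseteq> carrier R"
    show "J = P \<or> J = carrier R"
      using max[OF J(1) _ _ J(2)] P(2) J ideal.one_imp_carrier[OF J(1)] by blast
  qed (use P in auto)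
  thus ?thesis using maximalideal_prime P(2) by blast
qed

text \<open>The ideal generated by 1 - g is proper: 1 = x(1 - g) would give g = x(1 - g)g = 0. A
  prime above it cannot contain g as well, since g and 1 - g add up to 1.\<close>

lemma exists_primeideal_avoiding_idem:
  assumes g: "g \<in> idems R" "g \<noteq> \<zero>"
  shows "\<exists>P. primeideal P R \<and> g \<notin> P"
proof -
  have c: "g \<in> carrier R" and gg: "g \<otimes> g = g"
    using g by (auto simp: idems_def)
  have gd: "(\<one> \<ominus> g) \<otimes> g = \<zero>"
    using c gg by (simp add: minus_eq l_distr l_minus r_neg)
  have "\<one> \<notin> PIdl (\<one> \<ominus> g)"
  proof
    assume "\<one> \<in> PIdl (\<one> \<ominus> g)"
    then obtain x where x: "x \<in> carrier R" "\<one> = x \<otimes> (\<one> \<ominus> g)"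
      by (auto simp: cgenideal_def)
    have "g = x \<otimes> (\<one> \<ominus> g) \<otimes> g"
      using c by (simp flip: x(2))
    also have "\<dots> = \<zero>"
      using c x(1) by (simp add: m_assoc gd)
    finally show False using g by simp
  qed
  then obtain P where P: "primeideal P R" "PIdl (\<one> \<ominus> g) \<subseteq> P"
    using exists_primeideal_containing[OF cgenideal_ideal[of "\<one> \<ominus> g"]] c by auto
  interpret P: primeideal P R by fact
  have "\<one> \<ominus> g \<in> P"
    using P(2) cgenideal_self[of "\<one> \<ominus> g"] c by auto
  hence "g \<in> P \<Longrightarrow> (\<one> \<ominus> g) \<oplus> g \<in> P" by (intro P.a_closed)
  moreover have "(\<one> \<ominus> g) \<oplus> g = \<one>"
    using c by (simp add: minus_eq a_assoc l_neg)
  ultimately show ?thesis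
    using P(1) P.one_imp_carrier P.I_notcarr by metis
qed

text \<open>Two chains with the same ranks may differ in length by zero entries; this disposes of
  such tails.\<close>

lemma idem_mod_zeros:
  assumes "set es \<subseteq> {\<zero>}" "set fs \<subseteq> {\<zero>}"
  shows "mod_iso R (idem_mod R es) (idem_mod R fs)"
proof -
  have "v \<in> carrier (idem_mod R hs) \<longleftrightarrow> v = (\<lambda>_. \<zero>)" if "set hs \<subseteq> {\<zero>}" for v hs
  proof -
    have z: "hs ! i = \<zero>" if "i < length hs" for i
      using \<open>set hs \<subseteq> {\<zero>}\<close> that nth_mem by fastforce
    show ?thesis
    proof
      assume v: "v \<in> carrier (idem_mod R hs)"
      show "v = (\<lambda>_. \<zero>)"
      proof
        fix i
        show "v i = \<zero>"
        proof (cases "i < length hs")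
          case True
          hence "hs ! i \<otimes> v i = v i" "v i \<in> carrier R" using v by auto
          thus ?thesis using z[OF True] by simp
        qed (use v in simp)
      qed
    qed (auto simp: z)
  qed
  hence "carrier (idem_mod R es) = carrier (idem_mod R fs)"
    using assms by blast
  thus ?thesis
    by (intro mod_isoI[of _ _ _ id id]) (auto simp: lin_map_def simp del: idem_mod_simps(1))
qed

text \<open>If e(1 - f) were nonzero, some prime P would avoid it. Then e and 1 - f lie outside P,
  so f lies in P together with everything below it; one rank is 0 and the other is positive.\<close>

lemma idem_chain_head_le:
  assumes e: "e \<in> idems R" and fs: "idem_chain R (f # fs)"
    and rank: "\<And>P. primeideal P R \<Longrightarrow> idem_rank P (e # es) = idem_rank P (f # fs)"
  shows "e \<otimes> f = e"
proof -
  have c: "e \<in> carrier R" "f \<in> carrier R" and ff: "f \<otimes> f = f" and ee: "e \<otimes> e = e"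
    using e fs by (auto simp: idem_chain_def idems_def)
  define d where "d = \<one> \<ominus> f"
  have d: "d \<in> carrier R" using c by (simp add: d_def)
  have fd: "f \<otimes> d = \<zero>"
    using c ff by (simp add: d_def minus_eq r_distr r_minus r_neg)
  have fd1: "f \<oplus> d = \<one>"
    using c by (simp add: d_def minus_eq a_lcomm[of f] r_neg)
  have dd: "d \<otimes> d = d"
    using l_distr[of f d d] c d fd by (simp add: fd1)
  have "e \<otimes> d = \<zero>"
  proof (rule ccontr)
    assume "e \<otimes> d \<noteq> \<zero>"
    moreover have "(e \<otimes> d) \<otimes> (e \<otimes> d) = (e \<otimes> e) \<otimes> (d \<otimes> d)"
      using c d by (simp add: m_ac)
    hence "e \<otimes> d \<in> idems R"
      using c d by (simp add: idems_def ee dd)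
    ultimately obtain P where P: "primeideal P R" "e \<otimes> d \<notin> P"
      using exists_primeideal_avoiding_idem by blast
    interpret P: primeideal P R by fact
    have "e \<notin> P" "d \<notin> P"
      using P(2) c d P.I_l_closed P.I_r_closed by auto
    hence f: "f \<in> P"
      using P.I_prime[of f d] c d fd P.zero_closed by auto
    have "f' \<in> P" if "f' \<in> set fs" for f'
    proof -
      have "f' \<in> carrier R" "f \<otimes> f' = f'"
        using fs that by (auto simp: idem_chain_def idems_def)
      thus ?thesis using P.I_r_closed[OF f] by metis
    qed
    hence "idem_rank P (f # fs) = 0"
      using f by (auto simp: idem_rank_eq_0)
    thus False using rank[OF P(1)] \<open>e \<notin> P\<close> by simp
  qed
  thus ?thesis using r_distr[of f d e] c d by (simp add: fd1)
qed

lemma idem_chain_unique: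
  assumes "idem_chain R es" "idem_chain R fs"
    and "\<And>P. primeideal P R \<Longrightarrow> idem_rank P es = idem_rank P fs"
  shows "mod_iso R (idem_mod R es) (idem_mod R fs)"
  using assms
proof (induction es arbitrary: fs)
  \<comment> \<open>Rank 0 everywhere places every entry in every prime ideal, whereas a nonzero
    idempotent avoids one of them.\<close>
  have zeros: "set hs \<subseteq> {\<zero>}"
    if "idem_chain R hs" "\<And>P. primeideal P R \<Longrightarrow> idem_rank P hs = 0" for hs
    using that exists_primeideal_avoiding_idem by (fastforce simp: idem_rank_eq_0 idem_chain_def)
  {
    case Nil
    have "set fs \<subseteq> {\<zero>}"
      using Nil by (intro zeros) (simp_all flip: Nil.prems(3))
    thus ?case by (intro idem_mod_zeros) auto
  next
    case (Cons e es)
    show ?case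
    proof (cases fs)
      case Nil
      have "set (e # es) \<subseteq> {\<zero>}"
        using Cons.prems Nil by (intro zeros) (simp_all del: idem_rank_simps(2))
      thus ?thesis unfolding Nil by (intro idem_mod_zeros) auto
    next
      case fs: (Cons f fs')
      note prems = Cons.prems[unfolded fs]
      have c: "e \<in> idems R" "f \<in> idems R" "set es \<subseteq> idems R" "set fs' \<subseteq> idems R"
        using prems by (auto simp: idem_chain_def)
      have "e = e \<otimes> f"
        by (rule idem_chain_head_le[OF c(1) prems(2,3), symmetric])
      also have "\<dots> = f \<otimes> e" using c by (simp add: idems_def m_comm)
      also have "\<dots> = f"
        by (rule idem_chain_head_le[OF c(2) prems(1) prems(3)[symmetric]])
      finally have "e = f" .
      have "idem_rank P es = idem_rank P fs'" if "primeideal P R" for P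
        using prems(3)[OF that] \<open>e = f\<close> by (simp split: if_splits)
      hence "mod_iso R (idem_mod R es) (idem_mod R fs')"
        using prems by (intro Cons.IH) (auto simp: idem_chain_def)
      thus ?thesis
        unfolding fs \<open>e = f\<close> using c by (intro idem_mod_Cons_cong) auto
    qed
  }
qed

text \<open>A homogeneous linear system with fewer equations than unknowns has a solution that is
  nontrivial modulo \<open>P\<close>. The functionals \<open>c i\<close> are dual to the vectors \<open>g i\<close> modulo \<open>P\<close>, and
  eliminating one equation preserves this duality.\<close>
lemma underdetermined_system:
  assumes P: "primeideal P R" and M: "module R M"
    and c: "\<And>i. lin_map R M (ring_as_module R) (c i)"
    and l: "\<And>j. lin_map R M (ring_as_module R) (l j)"
  shows "finite J \<Longrightarrow> finite I \<Longrightarrow> card J < card I \<Longrightarrow> submodule V R M \<Longrightarrow>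
    (\<And>i. i \<in> I \<Longrightarrow> g i \<in> V) \<Longrightarrow> (\<And>i. i \<in> I \<Longrightarrow> c i (g i) \<notin> P) \<Longrightarrow>
    (\<And>i k. i \<in> I \<Longrightarrow> k \<in> I \<Longrightarrow> i \<noteq> k \<Longrightarrow> c i (g k) \<in> P) \<Longrightarrow>
    \<exists>v\<in>V. (\<forall>j\<in>J. l j v \<in> P) \<and> (\<exists>i\<in>I. c i v \<notin> P)"
proof (induction J arbitrary: I V g rule: finite_induct)
  case empty
  then obtain i where "i \<in> I" by fastforce
  thus ?case using empty by blast
next
  case (insert j J)
  interpret P: primeideal P R by fact
  interpret M: module R M by fact
  note sub = M.submoduleE[OF insert.prems(3)]
  have lin_c: "f x \<in> carrier R" if "lin_map R M (ring_as_module R) f" "x \<in> carrier M" for f x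
    using lin_map_closed[OF that(1)] that(2) by (simp add: ring_as_module_def)
  have lin_add: "f (x \<oplus>\<^bsub>M\<^esub> y) = f x \<oplus> f y"
    if "lin_map R M (ring_as_module R) f" "x \<in> carrier M" "y \<in> carrier M" for f x y
    using lin_map_add[OF that(1)] that(2,3) by (simp add: ring_as_module_def)
  have lin_smult: "f (a \<odot>\<^bsub>M\<^esub> x) = a \<otimes> f x"
    if "lin_map R M (ring_as_module R) f" "a \<in> carrier R" "x \<in> carrier M" for f a x
    using lin_map_smult[OF that(1)] that(2,3) by (simp add: ring_as_module_def)
  have l0: "l j \<zero>\<^bsub>M\<^esub> = \<zero>"
    using lin_smult[OF l zero_closed M.zero_closed, of j] lin_c[OF l M.zero_closed, of j] by simp
  \<comment> \<open>Restricting to the solutions of equation \<open>j\<close> modulo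
    \<open>P\<close> builds that equation into the submodule, so the induction hypothesis only has
    to treat \<open>J\<close>.\<close>
  define V' where "V' = {v \<in> V. l j v \<in> P}"
  have "\<zero>\<^bsub>M\<^esub> \<in> V"
    using insert.prems(3) by (simp add: submodule_def subgroup_def)
  have V': "submodule V' R M"
  proof (rule M.submoduleI_smult)
    show "\<zero>\<^bsub>M\<^esub> \<in> V'"
      using \<open>\<zero>\<^bsub>M\<^esub> \<in> V\<close> by (simp add: V'_def l0)
    show "x \<oplus>\<^bsub>M\<^esub> y \<in> V'" if "x \<in> V'" "y \<in> V'" for x y
    proof -
      have "x \<in> carrier M" "y \<in> carrier M" using that sub(1) by (auto simp: V'_def)
      thus ?thesis using that sub(5) lin_add[OF l] by (simp add: V'_def)
    qed
    show "a \<odot>\<^bsub>M\<^esub> x \<in> V'" if "a \<in> carrier R" "x \<in> V'" for a x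
    proof -
      have "x \<in> carrier M" using that sub(1) by (auto simp: V'_def)
      thus ?thesis using that sub(4) lin_smult[OF l] P.I_l_closed by (simp add: V'_def)
    qed
  qed (use sub in \<open>auto simp: V'_def\<close>)
  show ?case
  proof (cases "\<forall>i\<in>I. l j (g i) \<in> P")
    case True
    have "\<exists>v\<in>V'. (\<forall>j\<in>J. l j v \<in> P) \<and> (\<exists>i\<in>I. c i v \<notin> P)"
      by (rule insert.IH[OF insert.prems(1) _ V'])
         (use insert.hyps insert.prems True in \<open>auto simp: V'_def\<close>)
    thus ?thesis by (auto simp: V'_def)
  next
    case False
    then obtain i0 where i0: "i0 \<in> I" "l j (g i0) \<notin> P" by blast
    define a where "a = l j (g i0)"
    \<comment> \<open>Gaussian elimination without division: with the pivot a = l_j(g_i0) outside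
      \<open>P\<close>, the combination a g_i - l_j(g_i) g_i0 is annihilated by l_j because R is
      commutative.\<close>
    define h where "h i = a \<odot>\<^bsub>M\<^esub> g i \<oplus>\<^bsub>M\<^esub> (\<ominus> l j (g i)) \<odot>\<^bsub>M\<^esub> g i0" for i
    have gM: "g i \<in> carrier M" if "i \<in> I" for i
      using insert.prems(4)[OF that] sub(1) by blast
    have lc: "l j (g i) \<in> carrier R" "c k (g i) \<in> carrier R" if "i \<in> I" for i k
      using lin_c[OF _ gM[OF that]] l c by auto
    have a: "a \<in> carrier R" "a \<notin> P" using lc i0 by (auto simp: a_def)
    have fh: "f (h i) = a \<otimes> f (g i) \<oplus> (\<ominus> l j (g i)) \<otimes> f (g i0)"
      if "lin_map R M (ring_as_module R) f" "i \<in> I" for f i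
      using that lin_add[OF that(1)] lin_smult[OF that(1)] a gM i0 lc by (simp add: h_def)
    have "\<exists>v\<in>V'. (\<forall>j\<in>J. l j v \<in> P) \<and> (\<exists>i\<in>I - {i0}. c i v \<notin> P)"
    proof (rule insert.IH[OF _ _ V'])
      show "card J < card (I - {i0})"
        using insert.prems(1,2) insert.hyps i0 by simp
      fix i assume i: "i \<in> I - {i0}"
      have "h i \<in> V"
        unfolding h_def using i i0 a lc insert.prems(4) by (intro sub) auto
      moreover have "l j (h i) = \<zero>"
        using i i0 a lc by (simp add: fh l m_comm[of a] l_minus r_neg flip: a_def)
      ultimately show "h i \<in> V'" by (simp add: V'_def)
      \<comment> \<open>In c_i(h_i) = a c_i(g_i) - l_j(g_i) c_i(g_i0) the second term lies in
        \<open>P\<close> by duality, while the first avoids it because \<open>P\<close> is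
        prime.\<close>
      show "c i (h i) \<notin> P"
      proof
        let ?x = "a \<otimes> c i (g i)" and ?y = "(\<ominus> l j (g i)) \<otimes> c i (g i0)"
        assume "c i (h i) \<in> P"
        hence "?x \<oplus> ?y \<in> P" using i by (simp add: fh c)
        moreover have "?y \<in> P"
          using insert.prems(6)[of i i0] i i0 lc by (auto intro: P.I_l_closed)
        ultimately have "(?x \<oplus> ?y) \<oplus> (\<ominus> ?y) \<in> P"
          by (rule P.a_closed[OF _ P.a_inv_closed])
        moreover have "?x \<in> carrier R" "?y \<in> carrier R"
          using i i0 lc a by auto
        hence "(?x \<oplus> ?y) \<oplus> (\<ominus> ?y) = ?x"
          by (simp only: a_assoc r_neg a_inv_closed r_zero)
        ultimately have "?x \<in> P" by (simp only:)
        thus False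
          using P.I_prime[of a "c i (g i)"] a lc insert.prems(5)[of i] i by auto
      qed
      fix k assume k: "k \<in> I - {i0}" "i \<noteq> k"
      show "c i (h k) \<in> P"
        using i k i0 a lc insert.prems(6) by (auto simp: fh c intro!: P.a_closed P.I_l_closed)
    qed (use insert.prems in auto)
    thus ?thesis by (auto simp: V'_def)
  qed
qed

section \<open>Invariance of the rank at a prime\<close>

lemma idem_mod_unit:
  assumes "set es \<subseteq> idems R" "i < length es"
  shows "(\<lambda>k. if k = i then es ! i else \<zero>) \<in> carrier (idem_mod R es)"
  using assms nth_mem[OF assms(2)] by (auto simp: idems_def dest!: subsetD)

text \<open>A vector with entries in \<open>P\<close> is a combination of generators with
  coefficients in \<open>P\<close>, and linearity keeps those coefficients. The truncations
  \<open>t k\<close> assemble this combination one coordinate at a time.\<close>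

lemma lin_map_idem_mod_in_ideal:
  assumes P: "ideal P R" and es: "set es \<subseteq> idems R" "set fs \<subseteq> idems R"
    and f: "lin_map R (idem_mod R es) (idem_mod R fs) f"
    and v: "v \<in> carrier (idem_mod R es)" "\<And>i. v i \<in> P"
  shows "f v j \<in> P"
proof -
  interpret P: ideal P R by fact
  have es_mod: "module R (idem_mod R es)" and fs_mod: "module R (idem_mod R fs)"
    by (intro module_idem_mod idems_carrier es)+
  define t where "t k = (\<lambda>i. if i < k then v i else \<zero>)" for k
  have t: "t k \<in> carrier (idem_mod R es)" for k
  proof -
    have "es ! i \<otimes> \<zero> = \<zero>" if "i < length es" for i
      using es nth_mem[OF that] by (auto simp: idems_def)
    thus ?thesis using v by (auto simp: t_def)
  qed
  have "f (t k) j \<in> P" for k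
  proof (induction k)
    case 0
    have "t 0 = \<zero>\<^bsub>idem_mod R es\<^esub>" by (simp add: t_def)
    hence "f (t 0) = \<zero>\<^bsub>idem_mod R fs\<^esub>"
      by (simp only: lin_map_zero[OF es_mod fs_mod f])
    thus ?case by simp
  next
    case (Suc k)
    show ?case
    proof (cases "k < length es")
      case True
      \<comment> \<open>The entry is e_k and not 1, so that \<open>g\<close> lies in the module; as
        v_k e_k = v_k, the multiple of \<open>g\<close> by v_k is still the k-th component of
        \<open>v\<close>.\<close>
      define g where "g = (\<lambda>i. if i = k then es ! k else \<zero>)"
      have g: "g \<in> carrier (idem_mod R es)"
        unfolding g_def by (rule idem_mod_unit[OF es(1) True])
      have ek: "es ! k \<in> carrier R" and vk: "v k \<in> carrier R" "v k \<otimes> es ! k = v k"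
      proof -
        show ek: "es ! k \<in> carrier R"
          using es(1) nth_mem[OF True] by (auto simp: idems_def)
        show "v k \<in> carrier R" "v k \<otimes> es ! k = v k"
          using v(1) True ek by (auto simp: m_comm[of _ "es ! k"])
      qed
      have "t (Suc k) = t k \<oplus>\<^bsub>idem_mod R es\<^esub> (v k \<odot>\<^bsub>idem_mod R es\<^esub> g)"
        using vk idem_mod_coord[OF v(1)] by (auto simp: fun_eq_iff t_def g_def less_Suc_eq)
      moreover have "v k \<odot>\<^bsub>idem_mod R es\<^esub> g \<in> carrier (idem_mod R es)"
        by (rule module.smult_closed[OF es_mod vk(1) g])
      ultimately have "f (t (Suc k)) = f (t k) \<oplus>\<^bsub>idem_mod R fs\<^esub> (v k \<odot>\<^bsub>idem_mod R fs\<^esub> f g)"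
        using lin_map_add[OF f t] lin_map_smult[OF f vk(1) g] by metis
      hence "f (t (Suc k)) j = f (t k) j \<oplus> v k \<otimes> f g j" by simp
      moreover have "v k \<otimes> f g j \<in> P"
        by (intro P.I_r_closed v idem_mod_coord[OF lin_map_closed[OF f g]])
      ultimately show ?thesis using Suc by simp
    next
      case False
      hence "t (Suc k) = t k"
        using v(1) by (auto simp: t_def fun_eq_iff less_Suc_eq)
      thus ?thesis using Suc by simp
    qed
  qed
  moreover have "t (length es) = v"
    using v(1) by (auto simp: t_def fun_eq_iff)
  ultimately show ?thesis by metis
qed

text \<open>If there were more idempotents outside \<open>P\<close> in \<open>es\<close> than in
  \<open>fs\<close>, some v nontrivial modulo \<open>P\<close> would have f v trivial modulo
  \<open>P\<close>. Then g (f v) is trivial modulo \<open>P\<close> too, yet u s v = u g (f v) for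
  some u outside \<open>P\<close>; since s is also outside, primality forces v to be
  trivial.\<close>

lemma idem_rank_le:
  assumes P: "primeideal P R" and es: "set es \<subseteq> idems R" "set fs \<subseteq> idems R"
    and f: "lin_map R (idem_mod R es) (idem_mod R fs) f"
    and g: "lin_map R (idem_mod R fs) (idem_mod R es) g"
    and s: "s \<in> carrier R - P"
    and gf: "\<And>v. v \<in> carrier (idem_mod R es) \<Longrightarrow>
      \<exists>u\<in>carrier R - P. u \<odot>\<^bsub>idem_mod R es\<^esub> (s \<odot>\<^bsub>idem_mod R es\<^esub> v) = u \<odot>\<^bsub>idem_mod R es\<^esub> g (f v)"
  shows "idem_rank P es \<le> idem_rank P fs"
proof (rule ccontr)
  assume less: "\<not> idem_rank P es \<le> idem_rank P fs"
  interpret P: primeideal P R by fact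
  let ?M = "idem_mod R es"
  have M: "module R ?M"
    by (intro module_idem_mod idems_carrier es)+
  define I where "I = {i. i < length es \<and> es ! i \<notin> P}"
  define J where "J = {i. i < length fs \<and> fs ! i \<notin> P}"
  have coord: "lin_map R (idem_mod R hs) (ring_as_module R) (\<lambda>v. v i)" for hs i
    by (rule lin_mapI) (simp_all add: ring_as_module_def idem_mod_coord del: idem_mod_simps(1))
  \<comment> \<open>The unknowns are the coordinates in \<open>I\<close>, dual to the generators:
    the i-th coordinate of the i-th generator is e_i, outside \<open>P\<close>, and the other
    coordinates in \<open>I\<close> are 0. The equations need only cover \<open>J\<close>: a
    coordinate of f v at an idempotent inside \<open>P\<close> lies in \<open>P\<close>
    anyway.\<close>
  have "\<exists>v\<in>carrier ?M. (\<forall>j\<in>J. f v j \<in> P) \<and> (\<exists>i\<in>I. v i \<notin> P)"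
  proof (rule underdetermined_system[OF P M coord])
    show "lin_map R ?M (ring_as_module R) (\<lambda>v. f v j)" for j
      using lin_map_comp[OF f coord] by (simp add: comp_def)
    show "card J < card I"
      using less by (simp add: I_def J_def idem_rank_eq_card)
    show "(\<lambda>k. if k = i then es ! i else \<zero>) \<in> carrier ?M" if "i \<in> I" for i
      using that by (intro idem_mod_unit es) (simp add: I_def)
    show "submodule (carrier ?M) R ?M"
      by (rule module.carrier_is_submodule[OF M])
  qed (auto simp: I_def J_def P.zero_closed)
  then obtain v i where v: "v \<in> carrier ?M" "\<And>j. j \<in> J \<Longrightarrow> f v j \<in> P" "v i \<notin> P"
    by blast
  have fv: "f v \<in> carrier (idem_mod R fs)" by (rule lin_map_closed[OF f v(1)])
  have "f v j \<in> P" for j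
  proof (cases "j < length fs")
    case True
    show ?thesis
    proof (cases "fs ! j \<in> P")
      case True
      moreover have "fs ! j \<otimes> f v j = f v j" "f v j \<in> carrier R"
        using fv \<open>j < length fs\<close> by auto
      ultimately show ?thesis using P.I_r_closed by metis
    qed (use v(2) True in \<open>simp add: J_def\<close>)
  qed (use fv P.zero_closed in simp)
  hence gfv: "g (f v) i \<in> P"
    by (rule lin_map_idem_mod_in_ideal[OF P.is_ideal es(2,1) g fv])
  obtain u where u: "u \<in> carrier R - P"
    "u \<odot>\<^bsub>?M\<^esub> (s \<odot>\<^bsub>?M\<^esub> v) = u \<odot>\<^bsub>?M\<^esub> g (f v)"
    using gf[OF v(1)] by blast
  have "u \<otimes> (s \<otimes> v i) = u \<otimes> g (f v) i"
    using fun_cong[OF u(2), of i] by simp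
  hence "u \<otimes> (s \<otimes> v i) \<in> P"
    using u(1) gfv P.I_l_closed by simp
  moreover have "v i \<in> carrier R" by (rule idem_mod_coord[OF v(1)])
  ultimately show False
    using P.I_prime[of u "s \<otimes> v i"] P.I_prime[of s "v i"] u(1) s v(3) by auto
qed

end

subsection \<open>Localization\<close>

lemma ring_as_module_simps [simp]:
  "carrier (ring_as_module R) = carrier R"
  "a \<oplus>\<^bsub>ring_as_module R\<^esub> b = a \<oplus>\<^bsub>R\<^esub> b"
  "a \<odot>\<^bsub>ring_as_module R\<^esub> b = a \<otimes>\<^bsub>R\<^esub> b"
  by (simp_all add: ring_as_module_def)

lemma (in cring) module_ring_as_module: "module R (ring_as_module R)"
proof (intro moduleI abelian_groupI)
  show "\<exists>b\<in>carrier (ring_as_module R). b \<oplus>\<^bsub>ring_as_module R\<^esub> a = \<zero>\<^bsub>ring_as_module R\<^esub>"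
    if "a \<in> carrier (ring_as_module R)" for a
    using that by (intro bexI[of _ "\<ominus> a"]) (auto simp: ring_as_module_def l_neg)
qed (simp_all add: is_cring a_ac m_assoc l_distr r_distr, simp_all add: ring_as_module_def)

context primeideal
begin

definition denoms :: "'a set"
  where "denoms = carrier R - I"

lemma denoms_carrier: "s \<in> denoms \<Longrightarrow> s \<in> carrier R"
  by (simp add: denoms_def)

lemma one_denoms: "\<one> \<in> denoms"
  using one_imp_carrier I_notcarr by (auto simp: denoms_def)

lemma mult_denoms: "s \<in> denoms \<Longrightarrow> t \<in> denoms \<Longrightarrow> s \<otimes> t \<in> denoms"
  using I_prime by (auto simp: denoms_def)

lemma loc_rel_iff:
  assumes "module R M"
  shows "((m, s), (n, t)) \<in> loc_rel R I M \<longleftrightarrow> m \<in> carrier M \<and> n \<in> carrier M \<and> s \<in> denoms \<and> t \<in> denoms \<and>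
    (\<exists>u\<in>denoms. (u \<otimes> t) \<odot>\<^bsub>M\<^esub> m = (u \<otimes> s) \<odot>\<^bsub>M\<^esub> n)"
proof -
  interpret M: module R M by fact
  show ?thesis
    by (auto simp: loc_rel_def denoms_def M.smult_assoc1)
qed

lemma equiv_loc_rel:
  assumes "module R M"
  shows "equiv (carrier M \<times> denoms) (loc_rel R I M)"
proof (rule equivI)
  interpret M: module R M by fact
  show "loc_rel R I M \<subseteq> (carrier M \<times> denoms) \<times> (carrier M \<times> denoms)"
    by (auto simp: loc_rel_iff[OF assms])
  show "refl_on (carrier M \<times> denoms) (loc_rel R I M)"
    using one_denoms by (auto simp: refl_on_def loc_rel_iff[OF assms])
  show "sym (loc_rel R I M)"
    by (rule symI, clarify) (simp add: loc_rel_iff[OF assms], metis)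
  show "trans (loc_rel R I M)"
  proof (rule transI, clarify)
    fix m s n t k r
    assume "((m, s), (n, t)) \<in> loc_rel R I M" "((n, t), (k, r)) \<in> loc_rel R I M"
    then obtain u v where mem: "m \<in> carrier M" "n \<in> carrier M" "k \<in> carrier M"
        "s \<in> denoms" "t \<in> denoms" "r \<in> denoms" "u \<in> denoms" "v \<in> denoms"
      and u: "(u \<otimes> t) \<odot>\<^bsub>M\<^esub> m = (u \<otimes> s) \<odot>\<^bsub>M\<^esub> n"
      and v: "(v \<otimes> r) \<odot>\<^bsub>M\<^esub> n = (v \<otimes> t) \<odot>\<^bsub>M\<^esub> k"
      by (auto simp: loc_rel_iff[OF assms])
    note c = mem(4-8)[THEN denoms_carrier]
    \<comment> \<open>The witness u v t contains the middle denominator t, so that both given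
      relations can be applied in turn.\<close>
    have "((u \<otimes> v \<otimes> t) \<otimes> r) \<odot>\<^bsub>M\<^esub> m = (v \<otimes> r) \<odot>\<^bsub>M\<^esub> ((u \<otimes> t) \<odot>\<^bsub>M\<^esub> m)"
      using mem c by (simp add: m_ac flip: M.smult_assoc1)
    also have "\<dots> = (u \<otimes> s) \<odot>\<^bsub>M\<^esub> ((v \<otimes> r) \<odot>\<^bsub>M\<^esub> n)"
      unfolding u using mem c by (simp add: m_ac flip: M.smult_assoc1)
    also have "\<dots> = ((u \<otimes> v \<otimes> t) \<otimes> s) \<odot>\<^bsub>M\<^esub> k"
      unfolding v using mem c by (simp add: m_ac flip: M.smult_assoc1)
    finally show "((m, s), (k, r)) \<in> loc_rel R I M"
      using mem by (auto simp: loc_rel_iff[OF assms] intro!: bexI[of _ "u \<otimes> v \<otimes> t"] mult_denoms)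
  qed
qed

lemma loc_cls_eq_iff:
  assumes "module R M" "m \<in> carrier M" "s \<in> denoms" "n \<in> carrier M" "t \<in> denoms"
  shows "loc_cls R I M m s = loc_cls R I M n t \<longleftrightarrow> (\<exists>u\<in>denoms. (u \<otimes> t) \<odot>\<^bsub>M\<^esub> m = (u \<otimes> s) \<odot>\<^bsub>M\<^esub> n)"
  unfolding loc_cls_def using assms(2-)
  by (subst eq_equiv_class_iff[OF equiv_loc_rel[OF assms(1)]]) (auto simp: loc_rel_iff[OF assms(1)])

text \<open>Turning membership into equality of classes makes it possible to evaluate the unions
  over representatives by which the operations on a localization are defined.\<close>

lemma mem_loc_cls_iff:
  assumes "module R M" "m \<in> carrier M" "s \<in> denoms"
  shows "(n, t) \<in> loc_cls R I M m s \<longleftrightarrow> n \<in> carrier M \<and> t \<in> denoms \<and> loc_cls R I M n t = loc_cls R I M m s"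
proof -
  have "(n, t) \<in> loc_cls R I M m s \<longleftrightarrow> ((m, s), (n, t)) \<in> loc_rel R I M"
    by (simp add: loc_cls_def)
  also have "\<dots> \<longleftrightarrow> n \<in> carrier M \<and> t \<in> denoms \<and> loc_cls R I M m s = loc_cls R I M n t"
    using assms(2,3) by (simp add: loc_rel_iff[OF assms(1)] loc_cls_eq_iff[OF assms(1)] cong: conj_cong)
  finally show ?thesis by auto
qed

lemma loc_mod_carrier:
  "X \<in> carrier (loc_mod R I M) \<longleftrightarrow> (\<exists>m\<in>carrier M. \<exists>s\<in>denoms. X = loc_cls R I M m s)"
  by (auto simp: loc_mod_def loc_cls_def quotient_def denoms_def)

lemma loc_ring_carrier:
  "X \<in> carrier (loc_ring R I) \<longleftrightarrow> (\<exists>m\<in>carrier R. \<exists>s\<in>denoms. X = loc_cls R I (ring_as_module R) m s)"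
  by (auto simp: loc_ring_def Let_def loc_cls_def quotient_def denoms_def)

text \<open>The defining union collapses to a single class because the sum does not depend on the
  representatives: if u and v witness the two changes of fraction, then u v witnesses the change of
  the sum.\<close>

lemma loc_mod_add:
  assumes "module R M" "m \<in> carrier M" "s \<in> denoms" "n \<in> carrier M" "t \<in> denoms"
  shows "loc_cls R I M m s \<oplus>\<^bsub>loc_mod R I M\<^esub> loc_cls R I M n t =
    loc_cls R I M (t \<odot>\<^bsub>M\<^esub> m \<oplus>\<^bsub>M\<^esub> s \<odot>\<^bsub>M\<^esub> n) (s \<otimes> t)"
proof -
  interpret M: module R M by fact
  let ?cl = "loc_cls R I M"
  have eq: "?cl (t' \<odot>\<^bsub>M\<^esub> m' \<oplus>\<^bsub>M\<^esub> s' \<odot>\<^bsub>M\<^esub> n') (s' \<otimes> t') = ?cl (t \<odot>\<^bsub>M\<^esub> m \<oplus>\<^bsub>M\<^esub> s \<odot>\<^bsub>M\<^esub> n) (s \<otimes> t)"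
    if "(m', s') \<in> ?cl m s" "(n', t') \<in> ?cl n t" for m' s' n' t'
  proof -
    have mem: "m' \<in> carrier M" "n' \<in> carrier M" "s' \<in> denoms" "t' \<in> denoms"
      and "?cl m' s' = ?cl m s" "?cl n' t' = ?cl n t"
      using that assms by (simp_all add: mem_loc_cls_iff)
    then obtain u v where uv: "u \<in> denoms" "v \<in> denoms"
      and u: "(u \<otimes> s) \<odot>\<^bsub>M\<^esub> m' = (u \<otimes> s') \<odot>\<^bsub>M\<^esub> m"
      and v: "(v \<otimes> t) \<odot>\<^bsub>M\<^esub> n' = (v \<otimes> t') \<odot>\<^bsub>M\<^esub> n"
      using assms by (auto simp: loc_cls_eq_iff)
    note c = assms(3,5)[THEN denoms_carrier] mem(3,4)[THEN denoms_carrier] uv[THEN denoms_carrier]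
    have "(u \<otimes> v \<otimes> (s \<otimes> t)) \<odot>\<^bsub>M\<^esub> (t' \<odot>\<^bsub>M\<^esub> m' \<oplus>\<^bsub>M\<^esub> s' \<odot>\<^bsub>M\<^esub> n') =
      (v \<otimes> t \<otimes> t') \<odot>\<^bsub>M\<^esub> ((u \<otimes> s) \<odot>\<^bsub>M\<^esub> m') \<oplus>\<^bsub>M\<^esub> (u \<otimes> s \<otimes> s') \<odot>\<^bsub>M\<^esub> ((v \<otimes> t) \<odot>\<^bsub>M\<^esub> n')"
      using mem c by (simp add: M.smult_r_distr m_ac flip: M.smult_assoc1)
    also have "\<dots> = (u \<otimes> v \<otimes> (s' \<otimes> t')) \<odot>\<^bsub>M\<^esub> (t \<odot>\<^bsub>M\<^esub> m \<oplus>\<^bsub>M\<^esub> s \<odot>\<^bsub>M\<^esub> n)"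
      unfolding u v using assms c by (simp add: M.smult_r_distr m_ac flip: M.smult_assoc1)
    finally show ?thesis
      using assms mem c uv
      by (subst loc_cls_eq_iff) (auto intro!: mult_denoms bexI[of _ "u \<otimes> v"])
  qed
  have "(m, s) \<in> ?cl m s" "(n, t) \<in> ?cl n t"
    using assms by (simp_all add: mem_loc_cls_iff)
  hence "{?cl (t' \<odot>\<^bsub>M\<^esub> m' \<oplus>\<^bsub>M\<^esub> s' \<odot>\<^bsub>M\<^esub> n') (s' \<otimes> t') | m' s' n' t'. (m', s') \<in> ?cl m s \<and> (n', t') \<in> ?cl n t} =
    {?cl (t \<odot>\<^bsub>M\<^esub> m \<oplus>\<^bsub>M\<^esub> s \<odot>\<^bsub>M\<^esub> n) (s \<otimes> t)}"
    using eq by blast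
  thus ?thesis by (simp add: loc_mod_def Let_def)
qed

lemma loc_mod_smult:
  assumes "module R M" "a \<in> carrier R" "s \<in> denoms" "m \<in> carrier M" "t \<in> denoms"
  shows "loc_cls R I (ring_as_module R) a s \<odot>\<^bsub>loc_mod R I M\<^esub> loc_cls R I M m t =
    loc_cls R I M (a \<odot>\<^bsub>M\<^esub> m) (s \<otimes> t)"
proof -
  interpret M: module R M by fact
  let ?cl = "loc_cls R I M" and ?cR = "loc_cls R I (ring_as_module R)"
  note RM = module_ring_as_module
  have eq: "?cl (a' \<odot>\<^bsub>M\<^esub> m') (s' \<otimes> t') = ?cl (a \<odot>\<^bsub>M\<^esub> m) (s \<otimes> t)"
    if "(a', s') \<in> ?cR a s" "(m', t') \<in> ?cl m t" for a' s' m' t'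
  proof -
    have mem: "a' \<in> carrier R" "m' \<in> carrier M" "s' \<in> denoms" "t' \<in> denoms"
      and "?cR a' s' = ?cR a s" "?cl m' t' = ?cl m t"
      using that assms by (simp_all add: mem_loc_cls_iff RM)
    then obtain u v where uv: "u \<in> denoms" "v \<in> denoms"
      and u: "(u \<otimes> s) \<otimes> a' = (u \<otimes> s') \<otimes> a"
      and v: "(v \<otimes> t) \<odot>\<^bsub>M\<^esub> m' = (v \<otimes> t') \<odot>\<^bsub>M\<^esub> m"
      using assms by (auto simp: loc_cls_eq_iff RM)
    note c = assms(3,5)[THEN denoms_carrier] mem(3,4)[THEN denoms_carrier] uv[THEN denoms_carrier]
    have "(u \<otimes> v \<otimes> (s \<otimes> t)) \<odot>\<^bsub>M\<^esub> (a' \<odot>\<^bsub>M\<^esub> m') = ((u \<otimes> s) \<otimes> a') \<odot>\<^bsub>M\<^esub> ((v \<otimes> t) \<odot>\<^bsub>M\<^esub> m')"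
      using mem c by (simp add: m_ac flip: M.smult_assoc1)
    also have "\<dots> = (u \<otimes> v \<otimes> (s' \<otimes> t')) \<odot>\<^bsub>M\<^esub> (a \<odot>\<^bsub>M\<^esub> m)"
      unfolding u v using assms c by (simp add: m_ac flip: M.smult_assoc1)
    finally show ?thesis
      using assms mem c uv
      by (subst loc_cls_eq_iff) (auto intro!: mult_denoms bexI[of _ "u \<otimes> v"])
  qed
  have "(a, s) \<in> ?cR a s" "(m, t) \<in> ?cl m t"
    using assms by (simp_all add: mem_loc_cls_iff RM)
  hence "{?cl (a' \<odot>\<^bsub>M\<^esub> m') (s' \<otimes> t') | a' s' m' t'. (a', s') \<in> ?cR a s \<and> (m', t') \<in> ?cl m t} =
    {?cl (a \<odot>\<^bsub>M\<^esub> m) (s \<otimes> t)}"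
    using eq by blast
  thus ?thesis by (simp add: loc_mod_def Let_def)
qed

section \<open>Functoriality of localization and lifting of maps\<close>

lemma mod_iso_loc_mod:
  assumes M: "module R M" and N: "module R N" and iso: "mod_iso R M N"
  shows "mod_iso (loc_ring R I) (loc_mod R I M) (loc_mod R I N)"
proof -
  interpret M: module R M by fact
  interpret N: module R N by fact
  obtain f where f: "lin_map R M N f" and bij: "bij_betw f (carrier M) (carrier N)"
    using iso by (auto simp: mod_iso_def)
  note fc = lin_map_closed[OF f]
  let ?cM = "loc_cls R I M" and ?cN = "loc_cls R I N"
  \<comment> \<open>One direction makes the map m/s \<mapsto> f(m)/s independent of the chosen
    fraction, the other, which rests on injectivity of \<open>f\<close>, makes it injective.\<close>
  have eq_iff: "?cN (f m) s = ?cN (f n) t \<longleftrightarrow> ?cM m s = ?cM n t"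
    if "m \<in> carrier M" "s \<in> denoms" "n \<in> carrier M" "t \<in> denoms" for m s n t
  proof -
    have "f x = f y \<longleftrightarrow> x = y" if "x \<in> carrier M" "y \<in> carrier M" for x y
      using bij that by (auto simp: bij_betw_def inj_on_def)
    thus ?thesis
      using that by (simp add: loc_cls_eq_iff M N fc denoms_carrier flip: lin_map_smult[OF f])
  qed
  define F where "F X = (case SOME (m, s). m \<in> carrier M \<and> s \<in> denoms \<and> X = ?cM m s of (m, s) \<Rightarrow> ?cN (f m) s)" for X
  have F: "F (?cM m s) = ?cN (f m) s" if ms: "m \<in> carrier M" "s \<in> denoms" for m s
  proof -
    let ?Q = "\<lambda>(m', s'). m' \<in> carrier M \<and> s' \<in> denoms \<and> ?cM m s = ?cM m' s'"
    obtain m' s' where eq: "(SOME p. ?Q p) = (m', s')" by (cases "SOME p. ?Q p")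
    have "?Q (SOME p. ?Q p)" by (rule someI[of ?Q "(m, s)"]) (use ms in simp)
    thus ?thesis using ms eq by (simp add: F_def eq_iff)
  qed
  have rep: "\<exists>m s. m \<in> carrier M \<and> s \<in> denoms \<and> X = ?cM m s" if "X \<in> carrier (loc_mod R I M)" for X
    using that unfolding loc_mod_carrier by blast
  have lin: "lin_map (loc_ring R I) (loc_mod R I M) (loc_mod R I N) F"
  proof (rule lin_mapI)
    fix X assume "X \<in> carrier (loc_mod R I M)"
    then obtain m s where m: "m \<in> carrier M" "s \<in> denoms" and X: "X = ?cM m s"
      using rep by blast
    show "F X \<in> carrier (loc_mod R I N)"
      unfolding X F[OF m] loc_mod_carrier using fc[OF m(1)] m(2) by blast
    fix Y assume "Y \<in> carrier (loc_mod R I M)"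
    then obtain n t where n: "n \<in> carrier M" "t \<in> denoms" and Y: "Y = ?cM n t"
      using rep by blast
    show "F (X \<oplus>\<^bsub>loc_mod R I M\<^esub> Y) = F X \<oplus>\<^bsub>loc_mod R I N\<^esub> F Y"
      unfolding X Y using m n
      by (simp add: F M N fc loc_mod_add mult_denoms denoms_carrier lin_map_add[OF f] lin_map_smult[OF f])
  next
    fix A X assume "A \<in> carrier (loc_ring R I)" "X \<in> carrier (loc_mod R I M)"
    then obtain a s m t where a: "a \<in> carrier R" "s \<in> denoms" and A: "A = loc_cls R I (ring_as_module R) a s"
      and m: "m \<in> carrier M" "t \<in> denoms" and X: "X = ?cM m t"
      using rep unfolding loc_ring_carrier by blast
    show "F (A \<odot>\<^bsub>loc_mod R I M\<^esub> X) = A \<odot>\<^bsub>loc_mod R I N\<^esub> F X"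
      unfolding A X using a m
      by (simp add: F M N fc loc_mod_smult mult_denoms lin_map_smult[OF f])
  qed
  moreover have "bij_betw F (carrier (loc_mod R I M)) (carrier (loc_mod R I N))"
  proof (rule bij_betw_imageI)
    show "inj_on F (carrier (loc_mod R I M))"
    proof (rule inj_onI)
      fix X Y assume "X \<in> carrier (loc_mod R I M)" "Y \<in> carrier (loc_mod R I M)" and eq: "F X = F Y"
      then obtain m s n t where m: "m \<in> carrier M" "s \<in> denoms" and X: "X = ?cM m s"
        and n: "n \<in> carrier M" "t \<in> denoms" and Y: "Y = ?cM n t"
        using rep by meson
      show "X = Y"
        using eq m n unfolding X Y by (simp add: F eq_iff)
    qed
    have "Y \<in> F ` carrier (loc_mod R I M)" if "Y \<in> carrier (loc_mod R I N)" for Y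
    proof -
      from that obtain n s where n: "n \<in> carrier N" and s: "s \<in> denoms" and Y: "Y = ?cN n s"
        unfolding loc_mod_carrier by blast
      obtain m where m: "m \<in> carrier M" and "n = f m"
        using bij n by (auto simp: bij_betw_def)
      hence "Y = F (?cM m s)" using Y s by (simp add: F)
      moreover have "?cM m s \<in> carrier (loc_mod R I M)"
        unfolding loc_mod_carrier using m s by blast
      ultimately show ?thesis by (rule image_eqI)
    qed
    thus "F ` carrier (loc_mod R I M) = carrier (loc_mod R I N)"
      using lin_map_closed[OF lin] by blast
  qed
  ultimately show ?thesis by (auto simp: mod_iso_def)
qed

text \<open>A finitely generated module has finitely many generators, so the images of their fractions
  have a common denominator.\<close>
lemma loc_mod_lin_map_lift:
  assumes M: "fg_proj R M" and N: "module R N"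
    and \<phi>: "lin_map (loc_ring R I) (loc_mod R I M) (loc_mod R I N) \<phi>"
  shows "\<exists>f s. lin_map R M N f \<and> s \<in> denoms \<and>
    (\<forall>m\<in>carrier M. \<phi> (loc_cls R I M m \<one>) = loc_cls R I N (f m) s)"
proof -
  note M_mod = fg_projD[OF M]
  interpret M: module R M by (rule M_mod)
  interpret N: module R N by fact
  obtain n i p where i: "lin_map R M (free_mod R n) i" and p: "lin_map R (free_mod R n) M p"
    and pi: "\<And>x. x \<in> carrier M \<Longrightarrow> p (i x) = x"
    using M unfolding fg_proj_def by blast
  let ?F = "free_mod R n" and ?cM = "loc_cls R I M" and ?cN = "loc_cls R I N"
  note pc = lin_map_closed[OF p]
  \<comment> \<open>Truncation to the first k coordinates. Each step of the induction on k admits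
    one more basis vector, and the denominator picks up one more factor.\<close>
  define t where "t k v = (\<lambda>i. if i < k then v i else \<zero>)" for k and v :: "nat \<Rightarrow> 'a"
  have t: "t k v \<in> carrier ?F" if "v \<in> carrier ?F" for k v
    using that by (auto simp: t_def)
  have "\<exists>f s. lin_map R ?F N f \<and> s \<in> denoms \<and>
      (\<forall>v\<in>carrier ?F. \<phi> (?cM (p (t k v)) \<one>) = ?cN (f v) s)" if "k \<le> n" for k
    using that
  proof (induction k)
    case 0
    have "?cM \<zero>\<^bsub>M\<^esub> \<one> \<in> carrier (loc_mod R I M)"
      using one_denoms by (auto simp: loc_mod_carrier)
    then obtain m s where ms: "m \<in> carrier N" "s \<in> denoms" "\<phi> (?cM \<zero>\<^bsub>M\<^esub> \<one>) = ?cN m s"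
      using lin_map_closed[OF \<phi>] unfolding loc_mod_carrier by blast
    \<comment> \<open>Multiplying by the scalar 0/1 fixes 0/1 in the source and turns its image m/s
      into 0/s, so \<phi> sends zero to zero, with a denominator \<open>s\<close> taken from
      whatever fraction represents the image.\<close>
    let ?z = "loc_cls R I (ring_as_module R) \<zero> \<one>"
    have "?z \<in> carrier (loc_ring R I)"
      using one_denoms by (auto simp: loc_ring_carrier)
    from lin_map_smult[OF \<phi> this \<open>?cM \<zero>\<^bsub>M\<^esub> \<one> \<in> carrier (loc_mod R I M)\<close>]
    have "\<phi> (?cM \<zero>\<^bsub>M\<^esub> \<one>) = ?cN \<zero>\<^bsub>N\<^esub> s"
      using ms one_denoms denoms_carrier by (simp add: loc_mod_smult M_mod N)
    moreover have "p (t 0 v) = \<zero>\<^bsub>M\<^esub>" for v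
      using lin_map_zero[OF module_free_mod M_mod p] by (simp add: t_def)
    ultimately show ?case
      using ms(2) by (intro exI[of _ "\<lambda>_. \<zero>\<^bsub>N\<^esub>"] exI[of _ s]) (auto intro!: lin_mapI)
  next
    case (Suc k)
    then obtain f s where f: "lin_map R ?F N f" and s: "s \<in> denoms"
      and fs: "\<And>v. v \<in> carrier ?F \<Longrightarrow> \<phi> (?cM (p (t k v)) \<one>) = ?cN (f v) s"
      by auto
    note fc = lin_map_closed[OF f]
    define b where "b = (\<lambda>i. if i = k then \<one> else \<zero>)"
    have b: "b \<in> carrier ?F" using Suc.prems by (auto simp: b_def)
    have cls: "?cM (p v) \<one> \<in> carrier (loc_mod R I M)" if "v \<in> carrier ?F" for v
      using pc[OF that] one_denoms by (auto simp: loc_mod_carrier)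
    obtain m r where m: "m \<in> carrier N" and r: "r \<in> denoms" and mr: "\<phi> (?cM (p b) \<one>) = ?cN m r"
      using lin_map_closed[OF \<phi> cls[OF b]] unfolding loc_mod_carrier by blast
    \<comment> \<open>The numerator of f(v)/s + v_k m/r over the common denominator s r, where m/r
      is the image of the k-th basis vector.\<close>
    define f' where "f' v = r \<odot>\<^bsub>N\<^esub> f v \<oplus>\<^bsub>N\<^esub> (s \<otimes> v k) \<odot>\<^bsub>N\<^esub> m" for v
    note c = denoms_carrier[OF s] denoms_carrier[OF r]
    have "lin_map R ?F N f'"
    proof (rule lin_mapI)
      fix v assume v: "v \<in> carrier ?F"
      note vk = free_mod_coord[OF v, of k]
      show "f' v \<in> carrier N" using v vk c m fc by (simp add: f'_def del: free_mod_simps(1))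
      show "f' (a \<odot>\<^bsub>?F\<^esub> v) = a \<odot>\<^bsub>N\<^esub> f' v" if a: "a \<in> carrier R" for a
        using v a vk c m fc lin_map_smult[OF f a v]
        by (simp add: f'_def N.smult_r_distr m_ac del: free_mod_simps(1) flip: N.smult_assoc1)
      fix w assume w: "w \<in> carrier ?F"
      note wk = free_mod_coord[OF w, of k]
      show "f' (v \<oplus>\<^bsub>?F\<^esub> w) = f' v \<oplus>\<^bsub>N\<^esub> f' w"
        using v w vk wk c m fc lin_map_add[OF f v w]
        by (simp add: f'_def N.smult_r_distr N.smult_l_distr r_distr N.a_ac del: free_mod_simps(1))
    qed
    moreover have "\<phi> (?cM (p (t (Suc k) v)) \<one>) = ?cN (f' v) (s \<otimes> r)" if v: "v \<in> carrier ?F" for v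
    proof -
      let ?vk = "loc_cls R I (ring_as_module R) (v k) \<one>"
      note vk = free_mod_coord[OF v, of k]
      have vk': "?vk \<in> carrier (loc_ring R I)"
        using vk one_denoms by (auto simp: loc_ring_carrier)
      have "t (Suc k) v = t k v \<oplus>\<^bsub>?F\<^esub> (v k \<odot>\<^bsub>?F\<^esub> b)"
        using free_mod_coord[OF v] by (auto simp: t_def b_def fun_eq_iff less_Suc_eq)
      moreover have "v k \<odot>\<^bsub>?F\<^esub> b \<in> carrier ?F"
        by (rule module.smult_closed[OF module_free_mod vk b])
      ultimately have "p (t (Suc k) v) = p (t k v) \<oplus>\<^bsub>M\<^esub> v k \<odot>\<^bsub>M\<^esub> p b"
        using lin_map_add[OF p t[OF v]] lin_map_smult[OF p vk b] by metis
      hence "?cM (p (t (Suc k) v)) \<one> =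
          ?cM (p (t k v)) \<one> \<oplus>\<^bsub>loc_mod R I M\<^esub> (?vk \<odot>\<^bsub>loc_mod R I M\<^esub> ?cM (p b) \<one>)"
        using pc[OF t[OF v]] pc[OF b] vk one_denoms
        by (simp add: loc_mod_smult loc_mod_add M_mod)
      moreover have "?vk \<odot>\<^bsub>loc_mod R I M\<^esub> ?cM (p b) \<one> \<in> carrier (loc_mod R I M)"
        using pc[OF b] vk one_denoms by (auto simp: loc_mod_smult M_mod loc_mod_carrier)
      ultimately have "\<phi> (?cM (p (t (Suc k) v)) \<one>) =
          ?cN (f v) s \<oplus>\<^bsub>loc_mod R I N\<^esub> (?vk \<odot>\<^bsub>loc_mod R I N\<^esub> ?cN m r)"
        using lin_map_add[OF \<phi> cls[OF t[OF v]]] lin_map_smult[OF \<phi> vk' cls[OF b]] fs[OF v] mr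
        by metis
      also have "\<dots> = ?cN (f' v) (s \<otimes> r)"
        using fc[OF v] m r s vk one_denoms c
        by (simp add: loc_mod_smult loc_mod_add N f'_def N.smult_assoc1)
      finally show ?thesis .
    qed
    ultimately show ?case using mult_denoms[OF s r] by blast
  qed
  from this[of n] obtain f s where f: "lin_map R ?F N f" "s \<in> denoms"
    "\<And>v. v \<in> carrier ?F \<Longrightarrow> \<phi> (?cM (p (t n v)) \<one>) = ?cN (f v) s"
    by auto
  moreover have "t n v = v" if "v \<in> carrier ?F" for v
    using that by (auto simp: t_def fun_eq_iff)
  ultimately have "\<phi> (?cM m \<one>) = ?cN ((f \<circ> i) m) s" if "m \<in> carrier M" for m
    using f(3)[OF lin_map_closed[OF i that]] lin_map_closed[OF i that] pi[OF that]
    by (simp del: free_mod_simps)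
  hence h: "\<forall>m\<in>carrier M. \<phi> (?cM m \<one>) = ?cN ((f \<circ> i) m) s"
    by (intro ballI)
  show ?thesis
    by (rule exI[of _ "f \<circ> i"], rule exI[of _ s])
       (rule conjI[OF lin_map_comp[OF i f(1)] conjI[OF f(2) h]])
qed

text \<open>These closure facts allow a local isomorphism to be inverted by
  \<open>mod_isoE_closed\<close>.\<close>

lemma loc_mod_closed:
  assumes "module R M"
  shows "X \<in> carrier (loc_mod R I M) \<Longrightarrow> Y \<in> carrier (loc_mod R I M) \<Longrightarrow>
      X \<oplus>\<^bsub>loc_mod R I M\<^esub> Y \<in> carrier (loc_mod R I M)"
    and "A \<in> carrier (loc_ring R I) \<Longrightarrow> X \<in> carrier (loc_mod R I M) \<Longrightarrow>
      A \<odot>\<^bsub>loc_mod R I M\<^esub> X \<in> carrier (loc_mod R I M)"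
proof -
  interpret M: module R M by fact
  show "X \<oplus>\<^bsub>loc_mod R I M\<^esub> Y \<in> carrier (loc_mod R I M)"
    if "X \<in> carrier (loc_mod R I M)" "Y \<in> carrier (loc_mod R I M)"
  proof -
    from that obtain m s n t where m: "m \<in> carrier M" "s \<in> denoms" "X = loc_cls R I M m s"
      and n: "n \<in> carrier M" "t \<in> denoms" "Y = loc_cls R I M n t"
      unfolding loc_mod_carrier by blast
    have "t \<odot>\<^bsub>M\<^esub> m \<oplus>\<^bsub>M\<^esub> s \<odot>\<^bsub>M\<^esub> n \<in> carrier M"
      using m n by (simp add: denoms_carrier)
    with mult_denoms[OF m(2) n(2)] show ?thesis
      unfolding m(3) n(3) loc_mod_add[OF assms m(1,2) n(1,2)] loc_mod_carrier by blast
  qed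
  show "A \<odot>\<^bsub>loc_mod R I M\<^esub> X \<in> carrier (loc_mod R I M)"
    if "A \<in> carrier (loc_ring R I)" "X \<in> carrier (loc_mod R I M)"
  proof -
    from that obtain a s m t where a: "a \<in> carrier R" "s \<in> denoms" "A = loc_cls R I (ring_as_module R) a s"
      and m: "m \<in> carrier M" "t \<in> denoms" "X = loc_cls R I M m t"
      unfolding loc_mod_carrier loc_ring_carrier by blast
    have "a \<odot>\<^bsub>M\<^esub> m \<in> carrier M"
      using a m by simp
    with mult_denoms[OF a(2) m(2)] show ?thesis
      unfolding a(3) m(3) loc_mod_smult[OF assms a(1,2) m(1,2)] loc_mod_carrier by blast
  qed
qed

text \<open>Lift \<phi> to f with denominator t and \<psi> to g with denominator r. Then
  \<psi>\<phi> = id says that g(f(m)) equals r t m up to a factor outside the prime, so s = r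
  t.\<close>

lemma loc_mod_retraction_lift:
  assumes M: "fg_proj R M" and N: "fg_proj R N"
    and \<phi>: "lin_map (loc_ring R I) (loc_mod R I M) (loc_mod R I N) \<phi>"
    and \<psi>: "lin_map (loc_ring R I) (loc_mod R I N) (loc_mod R I M) \<psi>"
    and \<psi>\<phi>: "\<And>X. X \<in> carrier (loc_mod R I M) \<Longrightarrow> \<psi> (\<phi> X) = X"
  shows "\<exists>f g s. lin_map R M N f \<and> lin_map R N M g \<and> s \<in> denoms \<and>
    (\<forall>m\<in>carrier M. \<exists>u\<in>denoms. u \<odot>\<^bsub>M\<^esub> (s \<odot>\<^bsub>M\<^esub> m) = u \<odot>\<^bsub>M\<^esub> g (f m))"
proof -
  note M_mod = fg_projD[OF M] and N_mod = fg_projD[OF N]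
  interpret M: module R M by (rule M_mod)
  interpret N: module R N by (rule N_mod)
  let ?cM = "loc_cls R I M" and ?cN = "loc_cls R I N"
  obtain f t where f: "lin_map R M N f" and t: "t \<in> denoms"
    and ft: "\<And>m. m \<in> carrier M \<Longrightarrow> \<phi> (?cM m \<one>) = ?cN (f m) t"
    using loc_mod_lin_map_lift[OF M N_mod \<phi>] by blast
  obtain g r where g: "lin_map R N M g" and r: "r \<in> denoms"
    and gr: "\<And>n. n \<in> carrier N \<Longrightarrow> \<psi> (?cN n \<one>) = ?cM (g n) r"
    using loc_mod_lin_map_lift[OF N M_mod \<psi>] by blast
  note c = t[THEN denoms_carrier] r[THEN denoms_carrier]
  have "\<exists>u\<in>denoms. u \<odot>\<^bsub>M\<^esub> ((r \<otimes> t) \<odot>\<^bsub>M\<^esub> m) = u \<odot>\<^bsub>M\<^esub> g (f m)" if m: "m \<in> carrier M" for m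
  proof -
    have fm: "f m \<in> carrier N" by (rule lin_map_closed[OF f m])
    have gfm: "g (f m) \<in> carrier M" by (rule lin_map_closed[OF g fm])
    have tm: "t \<odot>\<^bsub>M\<^esub> m \<in> carrier M" using c m by simp
    \<comment> \<open>Starting from t m instead of m cancels the denominator t: the image is f(m)/1,
      a fraction to which the lift of \<psi> applies.\<close>
    have "\<phi> (?cM (t \<odot>\<^bsub>M\<^esub> m) \<one>) = ?cN (t \<odot>\<^bsub>N\<^esub> f m) t"
      using ft[OF tm] lin_map_smult[OF f c(1) m] by simp
    also have "\<dots> = ?cN (f m) \<one>"
      using c t fm one_denoms
      by (subst loc_cls_eq_iff[OF N_mod]) (auto intro!: bexI[of _ \<one>])
    finally have "\<psi> (\<phi> (?cM (t \<odot>\<^bsub>M\<^esub> m) \<one>)) = ?cM (g (f m)) r"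
      using gr[OF fm] by simp
    moreover have "?cM (t \<odot>\<^bsub>M\<^esub> m) \<one> \<in> carrier (loc_mod R I M)"
      unfolding loc_mod_carrier using tm one_denoms by blast
    ultimately have "?cM (t \<odot>\<^bsub>M\<^esub> m) \<one> = ?cM (g (f m)) r"
      by (simp only: \<psi>\<phi>)
    then obtain u where "u \<in> denoms" "(u \<otimes> r) \<odot>\<^bsub>M\<^esub> (t \<odot>\<^bsub>M\<^esub> m) = (u \<otimes> \<one>) \<odot>\<^bsub>M\<^esub> g (f m)"
      unfolding loc_cls_eq_iff[OF M_mod tm one_denoms gfm r] ..
    thus ?thesis
      using c m by (intro bexI[of _ u]) (simp_all add: denoms_carrier M.smult_assoc1)
  qed
  hence fg: "\<forall>m\<in>carrier M. \<exists>u\<in>denoms. u \<odot>\<^bsub>M\<^esub> ((r \<otimes> t) \<odot>\<^bsub>M\<^esub> m) = u \<odot>\<^bsub>M\<^esub> g (f m)"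
    by (intro ballI)
  show ?thesis
    by (rule exI[of _ f], rule exI[of _ g], rule exI[of _ "r \<otimes> t"])
       (intro conjI f g mult_denoms[OF r t] fg)
qed

end

text \<open>The lifted maps are transported along the isomorphisms of \<open>M\<close> and
  \<open>N\<close> with their idempotent modules. The identity \<psi>\<phi> = id yields this
  inequality; exchanging the two modules yields the reverse one.\<close>

lemma (in primeideal) loc_mod_iso_idem_rank_le:
  assumes M: "fg_proj R M" and N: "fg_proj R N"
    and \<phi>: "lin_map (loc_ring R I) (loc_mod R I M) (loc_mod R I N) \<phi>"
    and \<psi>: "lin_map (loc_ring R I) (loc_mod R I N) (loc_mod R I M) \<psi>"
    and \<psi>\<phi>: "\<And>X. X \<in> carrier (loc_mod R I M) \<Longrightarrow> \<psi> (\<phi> X) = X"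
    and es: "set es \<subseteq> idems R" "mod_iso R M (idem_mod R es)"
    and fs: "set fs \<subseteq> idems R" "mod_iso R N (idem_mod R fs)"
  shows "idem_rank I es \<le> idem_rank I fs"
proof -
  interpret M: module R M by (rule fg_projD[OF M])
  obtain f g s where f: "lin_map R M N f" and g: "lin_map R N M g" and s: "s \<in> denoms"
    and gf: "\<And>m. m \<in> carrier M \<Longrightarrow> \<exists>u\<in>denoms. u \<odot>\<^bsub>M\<^esub> (s \<odot>\<^bsub>M\<^esub> m) = u \<odot>\<^bsub>M\<^esub> g (f m)"
    using loc_mod_retraction_lift[OF M N \<phi> \<psi> \<psi>\<phi>] by blast
  obtain a a' where a: "lin_map R M (idem_mod R es) a" and a': "lin_map R (idem_mod R es) M a'"
    and aa': "\<And>v. v \<in> carrier (idem_mod R es) \<Longrightarrow> a (a' v) = v"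
    by (rule mod_isoE[OF es(2) fg_projD[OF M]]) blast
  obtain b b' where b: "lin_map R N (idem_mod R fs) b" and b': "lin_map R (idem_mod R fs) N b'"
    and b'b: "\<And>n. n \<in> carrier N \<Longrightarrow> b' (b n) = n"
    by (rule mod_isoE[OF fs(2) fg_projD[OF N]]) blast
  show ?thesis
  proof (rule idem_rank_le[OF primeideal es(1) fs(1)])
    show "lin_map R (idem_mod R es) (idem_mod R fs) (b \<circ> (f \<circ> a'))"
      by (intro lin_map_comp[OF _ b] lin_map_comp[OF a' f])
    show "lin_map R (idem_mod R fs) (idem_mod R es) (a \<circ> (g \<circ> b'))"
      by (intro lin_map_comp[OF _ a] lin_map_comp[OF b' g])
    show "s \<in> carrier R - I" using s by (simp add: denoms_def)
    fix v assume v: "v \<in> carrier (idem_mod R es)"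
    have m: "a' v \<in> carrier M" by (rule lin_map_closed[OF a' v])
    have n: "f (a' v) \<in> carrier N" by (rule lin_map_closed[OF f m])
    obtain u where u: "u \<in> denoms" "u \<odot>\<^bsub>M\<^esub> (s \<odot>\<^bsub>M\<^esub> a' v) = u \<odot>\<^bsub>M\<^esub> g (f (a' v))"
      using gf[OF m] by blast
    note c = denoms_carrier[OF u(1)] denoms_carrier[OF s]
    have "u \<odot>\<^bsub>idem_mod R es\<^esub> (s \<odot>\<^bsub>idem_mod R es\<^esub> v) = a (u \<odot>\<^bsub>M\<^esub> (s \<odot>\<^bsub>M\<^esub> a' v))"
      using c m v by (simp add: lin_map_smult[OF a] aa' del: idem_mod_simps)
    also have "\<dots> = u \<odot>\<^bsub>idem_mod R es\<^esub> (a \<circ> (g \<circ> b')) ((b \<circ> (f \<circ> a')) v)"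
      unfolding u(2) using c n lin_map_closed[OF g n]
      by (simp add: lin_map_smult[OF a] b'b del: idem_mod_simps)
    finally show "\<exists>u\<in>carrier R - I. u \<odot>\<^bsub>idem_mod R es\<^esub> (s \<odot>\<^bsub>idem_mod R es\<^esub> v) =
        u \<odot>\<^bsub>idem_mod R es\<^esub> (a \<circ> (g \<circ> b')) ((b \<circ> (f \<circ> a')) v)"
      using u(1) by (auto simp: denoms_def)
  qed
qed

theorem theorem2p2:
  fixes R :: "('a, 'c) ring_scheme"
    and M :: "('a, 'b, 'd) module_scheme"
    and N :: "('a, 'e, 'f) module_scheme"
  assumes "cring R"
    and "refinement_ring R"
    and "fg_proj R M"
    and "fg_proj R N"
  shows "mod_iso R M N \<longleftrightarrow>
         (\<forall>P. primeideal P R \<longrightarrow> mod_iso (loc_ring R P) (loc_mod R P M) (loc_mod R P N))"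
proof (intro iffI allI impI)
  fix P assume "mod_iso R M N" "primeideal P R"
  thus "mod_iso (loc_ring R P) (loc_mod R P M) (loc_mod R P N)"
    by (intro primeideal.mod_iso_loc_mod fg_projD assms)
next
  assume loc: "\<forall>P. primeideal P R \<longrightarrow> mod_iso (loc_ring R P) (loc_mod R P M) (loc_mod R P N)"
  interpret cring R by fact
  note M = fg_projD[OF assms(3)] and N = fg_projD[OF assms(4)]
  obtain es where es: "idem_chain R es" "mod_iso R M (idem_mod R es)"
    using fg_proj_idem_mod[OF assms(2,3)] idem_chain_exists mod_iso_trans by blast
  obtain fs where fs: "idem_chain R fs" "mod_iso R N (idem_mod R fs)"
    using fg_proj_idem_mod[OF assms(2,4)] idem_chain_exists mod_iso_trans by blast
  have idems: "set es \<subseteq> idems R" "set fs \<subseteq> idems R"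
    using es fs by (auto simp: idem_chain_def)
  have "idem_rank P es = idem_rank P fs" if P: "primeideal P R" for P
  proof -
    interpret P: primeideal P R by fact
    have iso: "mod_iso (loc_ring R P) (loc_mod R P M) (loc_mod R P N)"
      using loc P by blast
    obtain \<phi> \<psi> where \<phi>: "lin_map (loc_ring R P) (loc_mod R P M) (loc_mod R P N) \<phi>"
      and \<psi>: "lin_map (loc_ring R P) (loc_mod R P N) (loc_mod R P M) \<psi>"
      and \<psi>\<phi>: "\<And>X. X \<in> carrier (loc_mod R P M) \<Longrightarrow> \<psi> (\<phi> X) = X"
      and \<phi>\<psi>: "\<And>X. X \<in> carrier (loc_mod R P N) \<Longrightarrow> \<phi> (\<psi> X) = X"
      by (rule mod_isoE_closed[OF iso P.loc_mod_closed[OF M]], assumption+)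
         (rule that, assumption, assumption, simp_all)
    show ?thesis
      using P.loc_mod_iso_idem_rank_le[OF assms(3,4) \<phi> \<psi> \<psi>\<phi> idems(1) es(2) idems(2) fs(2)]
        P.loc_mod_iso_idem_rank_le[OF assms(4,3) \<psi> \<phi> \<phi>\<psi> idems(2) fs(2) idems(1) es(2)]
      by simp
  qed
  hence "mod_iso R (idem_mod R es) (idem_mod R fs)"
    by (rule idem_chain_unique[OF es(1) fs(1)])
  moreover have "mod_iso R (idem_mod R fs) N"
    by (rule mod_iso_sym[OF fs(2) N])
  ultimately show "mod_iso R M N"
    by (rule mod_iso_trans[OF es(2) mod_iso_trans])
qed

end
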